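(* Consider the operator $H$ in $L^2(\mathbb{R}_+)$ defined by $$H\psi=-\psi''(x)-\sigma V(x)\psi(x),\quad x>0,\qquad \psi'(0)=0,\qquad\text{where}\quad \int_0^\infty x|V(x)|\,dx<\infty .$$ If $\int_0^\infty V(x)\,dx\ge 0$, then $H$ has a negative eigenvalue $\lambda=\lambda(\sigma)$ for each $\sigma>0$.
   Context: $\mathbb{R}_+=(0,\infty)$, and $V$ is a real-valued potential on $\mathbb{R}_+$. The condition $\psi'(0)=0$ is the Neumann boundary condition at $x=0$.
   Formalization: V is additionally assumed not almost everywhere zero (for V = 0 the operator has no eigenvalue, so the claim fails), and V is assumed Lebesgue integrable on the half-line, so that the integral of V and the Neumann condition at 0 make sense. *)

theory Defs
  imports "HOL-Analysis.Analysis"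
begin

abbreviation Rplus :: "real measure" where
  "Rplus \<equiv> lebesgue_on {0<..}"

text \<open>Elements of the Hilbert space are represented by functions; two functions that agree
  almost everywhere on the half-line represent the same element.\<close>

definition L2_Rplus :: "(real \<Rightarrow> complex) set" where
  "L2_Rplus = {f. f \<in> borel_measurable Rplus \<and> integrable Rplus (\<lambda>x. (norm (f x))\<^sup>2)}"

text \<open>A finite family of non-overlapping subintervals \<open>[u, v]\<close> is encoded as a finite set of
  pairs \<open>(u, v)\<close>; degenerate intervals are harmless, as they contribute 0 to both sums.\<close>

definition absolutely_continuous_on_interval ::
    "real \<Rightarrow> real \<Rightarrow> (real \<Rightarrow> 'a::real_normed_vector) \<Rightarrow> bool" where
  "absolutely_continuous_on_interval a b f \<longleftrightarrow>
     (\<forall>\<epsilon>>0. \<exists>\<delta>>0. \<forall>D :: (real \<times> real) set.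
        finite D \<longrightarrow>
        (\<forall>(u, v)\<in>D. a \<le> u \<and> u \<le> v \<and> v \<le> b) \<longrightarrow>
        pairwise (\<lambda>(u, v) (s, t). disjnt {u<..<v} {s<..<t}) D \<longrightarrow>
        (\<Sum>(u, v)\<in>D. v - u) < \<delta> \<longrightarrow>
        (\<Sum>(u, v)\<in>D. norm (f v - f u)) < \<epsilon>)"

text \<open>The derivative on the closed half-line: two-sided for \<open>x > 0\<close>, one-sided at 0.\<close>

definition deriv_Rplus :: "(real \<Rightarrow> complex) \<Rightarrow> real \<Rightarrow> complex" where
  "deriv_Rplus \<psi> x = vector_derivative \<psi> (at x within {0..})"

text \<open>The second derivative is the pointwise one. On the domain below \<open>\<psi>'\<close> is locally absolutely
  continuous, so \<open>\<psi>''\<close> exists almost everywhere and the result is determined up to a null set.\<close>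

definition schroedinger_op ::
    "real \<Rightarrow> (real \<Rightarrow> real) \<Rightarrow> (real \<Rightarrow> complex) \<Rightarrow> real \<Rightarrow> complex" where
  "schroedinger_op \<sigma> V \<psi> x =
     - vector_derivative (deriv_Rplus \<psi>) (at x) - complex_of_real (\<sigma> * V x) * \<psi> x"

text \<open>The maximal domain subject to the Neumann condition. Each element of the domain, as a class in
  \<open>L\<^sup>2\<close>, is given here by its continuously differentiable representative; the values of that
  representative on the negative axis are irrelevant.\<close>

definition neumann_domain :: "real \<Rightarrow> (real \<Rightarrow> real) \<Rightarrow> (real \<Rightarrow> complex) set" where
  "neumann_domain \<sigma> V =
     {\<psi> \<in> L2_Rplus.
        (\<forall>x\<ge>0. \<psi> differentiable (at x within {0..})) \<and>
        (\<forall>R>0. absolutely_continuous_on_interval 0 R (deriv_Rplus \<psi>)) \<and>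
        deriv_Rplus \<psi> 0 = 0 \<and>
        schroedinger_op \<sigma> V \<psi> \<in> L2_Rplus}"

definition eigenvalue_Rplus ::
    "(real \<Rightarrow> complex) set \<Rightarrow> ((real \<Rightarrow> complex) \<Rightarrow> real \<Rightarrow> complex) \<Rightarrow> complex \<Rightarrow> bool" where
  "eigenvalue_Rplus D T \<mu> \<longleftrightarrow>
     (\<exists>\<psi>\<in>D. \<not> (AE x in Rplus. \<psi> x = 0) \<and> (AE x in Rplus. T \<psi> x = \<mu> * \<psi> x))"

end

theory Submission
  imports Defs
begin

text \<open>
  Write \<open>q = - \<sigma> V\<close>. A negative eigenvalue \<open>- k\<^sup>2\<close> with \<open>k > 0\<close> is a value of \<open>k\<close> for which the
  solution of \<open>f'' = (k\<^sup>2 + q) f\<close> that decays at infinity satisfies \<open>f'(0) = 0\<close>. The decaying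
  solution is the Jost solution \<open>f(x) = e\<^bsup>-kx\<^esup> m(k, x)\<close> with \<open>m \<rightarrow> 1\<close> at infinity, so the task is to
  find a zero \<open>k > 0\<close> of the shooting function \<open>F(k) = m'(k, 0) - k m(k, 0)\<close>. It is found by the
  intermediate value theorem.

  The moment condition makes the Volterra equation for \<open>m\<close> a contraction in a weighted supremum norm,
  uniformly in \<open>k \<ge> 0\<close> down to and including \<open>k = 0\<close>. Solving it simultaneously for all \<open>k\<close> in a space
  of bounded continuous functions of \<open>(k, x)\<close> gives joint continuity (\<open>jost_family_exists\<close>).
  For large \<open>k\<close> one has \<open>m \<approx> 1\<close> while \<open>m'\<close> stays bounded, so \<open>F(k) < 0\<close>. It remains to find one
  \<open>k\<^sub>0 \<ge> 0\<close> with \<open>F(k\<^sub>0) > 0\<close> (\<open>exists_shooting_pos\<close>); there are two cases.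

  \<^item> If the zero-energy solution \<open>m(0, \<cdot>)\<close> is positive on the closed half-line, its logarithmic
    derivative \<open>w = m'/m\<close> satisfies the Riccati equation \<open>w' = q - w\<^sup>2\<close> and vanishes at infinity.
    Hence \<open>w(0) = - \<integral>q + \<integral>w\<^sup>2\<close>, where \<open>- \<integral>q = \<sigma> \<integral>V \<ge> 0\<close>, and \<open>\<integral>w\<^sup>2 > 0\<close> because \<open>w = 0\<close> would
    force \<open>q = 0\<close>. So \<open>F(0) = m'(0, 0) > 0\<close> (\<open>dm_0_pos_if_m_pos\<close>).

  \<^item> Otherwise let \<open>k\<^sub>0\<close> be the largest \<open>k \<ge> 0\<close> for which \<open>m(k, \<cdot>)\<close> is somewhere nonpositive. Then
    \<open>m(k\<^sub>0, \<cdot>) \<ge> 0\<close> has a zero, which cannot be an interior minimum by uniqueness for the differential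
    equation (\<open>no_zero_data\<close>). So the zero is at the origin, and \<open>F(k\<^sub>0) = m'(k\<^sub>0, 0) > 0\<close>.

  The remaining work is to see that the Jost solution at a zero of \<open>F\<close> lies in the operator domain and
  satisfies the eigenvalue equation (\<open>eigenvalue_if_shooting_zero\<close>). As \<open>V\<close> is only integrable, \<open>f''\<close>
  exists merely almost everywhere; this rests on the Lebesgue differentiation theorem on the line
  (\<open>negligible_Lebesgue_nondifferentiable\<close>).
\<close>

section \<open>Almost everywhere differentiation of indefinite integrals\<close>

text \<open>
  Let \<open>E e\<close> be the set of points at which difference quotients of the indefinite integral differ from
  \<open>f\<close> by at least \<open>e\<close> on arbitrarily short intervals. Such intervals form a Vitali cover of \<open>E e\<close>,
  and any finite disjoint subfamily, tagged at the offending end points, is a fine partial division. The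
  Henstock lemma bounds its total error, hence its total length, by an arbitrarily small number, so
  \<open>E e\<close> is negligible.
\<close>
lemma negligible_Lebesgue_nondifferentiable:
  fixes f :: "real \<Rightarrow> real"
  assumes f: "f integrable_on {a..b}"
  shows "negligible {x\<in>{a..b}. \<not> ((\<lambda>y. integral {a..y} f) has_real_derivative f x) (at x within {a..b})}"
proof -
  define F where "F = (\<lambda>y. integral {a..y} f)"
  have F_diff: "F d - F c = integral {c..d} f" if "a \<le> c" "c \<le> d" "d \<le> b" for c d
  proof -
    have "f integrable_on {a..d}"
      using f by (rule integrable_on_subinterval) (use that in auto)
    from Henstock_Kurzweil_Integration.integral_combine[OF that(1,2) this] show ?thesis
      by (simp add: F_def)
  qed
  define E where "E = (\<lambda>e. {x\<in>{a..b}. \<forall>\<delta>>0. \<exists>y\<in>{a..b}. y \<noteq> x \<and> \<bar>y - x\<bar> < \<delta> \<and>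
      e * \<bar>y - x\<bar> \<le> \<bar>F y - F x - f x * (y - x)\<bar>})"
  have neg: "negligible (E e)" if e: "e > 0" for e
    unfolding negligible_outer_le
  proof (intro allI impI)
    fix \<eta> :: real assume "\<eta> > 0"
    with e have "e * \<eta> > 0" by simp
    from f have f': "f integrable_on cbox a b" by simp
    obtain \<gamma> where \<gamma>: "gauge \<gamma>"
      and hen: "\<And>p. p tagged_partial_division_of cbox a b \<Longrightarrow> \<gamma> fine p \<Longrightarrow>
        (\<Sum>(x,k)\<in>p. norm (measure lborel k *\<^sub>R f x - integral k f)) < e * \<eta>"
      by (rule Henstock_lemma[OF f' \<open>e * \<eta> > 0\<close>]) (rule that, assumption, blast)
    \<comment> \<open>The interval between \<open>x\<close> and \<open>y\<close>, in the form that the Vitali covering theorem expects.\<close>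
    define I where "I = (\<lambda>(x, y). cball ((x + y) / 2 :: real) (\<bar>y - x\<bar> / 2))"
    \<comment> \<open>A pair \<open>(x, y)\<close> stands for the closed interval between \<open>x\<close> and \<open>y\<close>, on either side of its tag \<open>x\<close>.\<close>
    define K where "K = {(x, y). x \<in> E e \<and> y \<in> {a..b} \<and> y \<noteq> x \<and> I (x, y) \<subseteq> \<gamma> x \<and>
      e * \<bar>y - x\<bar> \<le> \<bar>F y - F x - f x * (y - x)\<bar>}"
    have I_eq: "I (x, y) = {min x y..max x y}" for x y
      by (auto simp: I_def cball_def dist_real_def abs_if min_def max_def field_simps)
    obtain C where C: "countable C" "C \<subseteq> K"
        "pairwise (\<lambda>i j. disjnt (I i) (I j)) C"
        "negligible (E e - (\<Union>i \<in> C. I i))"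
    proof (rule Vitali_covering_theorem_cballs[of K "\<lambda>(x,y). \<bar>y - x\<bar> / 2" "E e" "\<lambda>(x,y). (x + y) / 2"])
      show "0 < (case i of (x, y) \<Rightarrow> \<bar>y - x\<bar> / 2)" if "i \<in> K" for i
        using that by (auto simp: K_def)
      show "\<exists>i. i \<in> K \<and> x \<in> cball (case i of (x, y) \<Rightarrow> (x + y) / 2) (case i of (x, y) \<Rightarrow> \<bar>y - x\<bar> / 2) \<and>
          (case i of (x, y) \<Rightarrow> \<bar>y - x\<bar> / 2) < d" if x: "x \<in> E e" and "0 < d" for x d
      proof -
        from \<gamma> obtain r where r: "r > 0" "ball x r \<subseteq> \<gamma> x"
          unfolding gauge_def by (meson openE)
        have "min d r > 0" using \<open>d > 0\<close> r(1) by simp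
        with x obtain y where y: "y \<in> {a..b}" "y \<noteq> x" "\<bar>y - x\<bar> < min d r"
          "e * \<bar>y - x\<bar> \<le> \<bar>F y - F x - f x * (y - x)\<bar>"
          unfolding E_def by blast
        have "I (x, y) \<subseteq> ball x r"
          using y(3) by (auto simp: I_eq ball_def dist_real_def)
        then have "(x, y) \<in> K"
          using x y r by (auto simp: K_def)
        moreover have "x \<in> I (x, y)" by (auto simp: I_eq)
        ultimately show ?thesis
          using y by (intro exI[of _ "(x,y)"]) (auto simp: I_def)
      qed
    qed (use that in \<open>auto simp: I_def case_prod_beta\<close>)
    have I_meas: "I i \<in> lmeasurable" for i
      by (cases i) (simp add: I_eq)
    have bound: "measure lebesgue (\<Union>i\<in>C'. I i) \<le> \<eta>" if C': "C' \<subseteq> C" "finite C'" for C'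
    proof -
      define p where "p = (\<lambda>i. (fst i, I i)) ` C'"
      have KK: "C' \<subseteq> K" using C' C by auto
      have C'E: "x \<in> {a..b}" "y \<in> {a..b}" "x \<noteq> y" if "(x, y) \<in> C'" for x y
        using that KK by (auto simp: K_def E_def)
      have tag: "p tagged_partial_division_of cbox a b"
        unfolding tagged_partial_division_of_def
      proof (intro conjI allI impI; (elim conjE)?)
        show "finite p" using C' by (simp add: p_def)
        fix x k assume xk: "(x, k) \<in> p"
        then obtain y where y: "(x, y) \<in> C'" "k = I (x, y)" by (auto simp: p_def)
        show "x \<in> k" "\<exists>a b. k = cbox a b" using y by (auto simp: I_eq)
        show "k \<subseteq> cbox a b" using C'E[OF y(1)] y by (auto simp: I_eq)
        fix x' k' assume xk': "(x', k') \<in> p" and ne: "(x, k) \<noteq> (x', k')"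
        then obtain y' where y': "(x', y') \<in> C'" "k' = I (x', y')" unfolding p_def by force
        have "(x, y) \<noteq> (x', y')" using ne y y' by auto
        then have "disjnt k k'"
          using C(3) y y' C'(1) unfolding pairwise_def by (metis subsetD)
        then show "interior k \<inter> interior k' = {}"
          using interior_subset[of k] interior_subset[of k'] by (auto simp: disjnt_def)
      qed
      have fine: "\<gamma> fine p"
        using KK unfolding fine_def p_def K_def by fastforce
      have inj: "inj_on (\<lambda>i. (fst i, I i)) C'"
      proof (rule inj_onI)
        fix i j assume ij: "i \<in> C'" "j \<in> C'" "(fst i, I i) = (fst j, I j)"
        show "i = j"
        proof (rule ccontr)
          assume "i \<noteq> j"
          then have "disjnt (I i) (I j)" using C(3) ij C'(1) unfolding pairwise_def by blast
          moreover have "fst i \<in> I i" by (cases i) (auto simp: I_eq)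
          ultimately show False using ij(3) by (auto simp: disjnt_def)
        qed
      qed
      have step: "e * measure lebesgue (I i) \<le> norm (measure lborel (I i) *\<^sub>R f (fst i) - integral (I i) f)"
        if "i \<in> C'" for i
      proof -
        obtain x y where i: "i = (x, y)" by (cases i)
        have xy: "x \<in> {a..b}" "y \<in> {a..b}" "x \<noteq> y" and
          ineq: "e * \<bar>y - x\<bar> \<le> \<bar>F y - F x - f x * (y - x)\<bar>"
          using that KK C'E by (auto simp: i K_def)
        have meas: "measure lebesgue (I i) = \<bar>y - x\<bar>" "measure lborel (I i) = \<bar>y - x\<bar>"
          by (auto simp: i I_eq)
        show ?thesis
        proof (cases "x \<le> y")
          case True
          then show ?thesis using ineq F_diff[of x y] xy unfolding meas
            by (simp add: i I_eq algebra_simps abs_minus_commute)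
        next
          case False
          then show ?thesis using ineq F_diff[of y x] xy unfolding meas
            by (simp add: i I_eq algebra_simps abs_minus_commute)
        qed
      qed
      have "e * measure lebesgue (\<Union>i\<in>C'. I i) \<le> e * (\<Sum>i\<in>C'. measure lebesgue (I i))"
        using e C' I_meas by (intro mult_left_mono measure_UNION_le) auto
      also have "\<dots> \<le> (\<Sum>i\<in>C'. norm (measure lborel (I i) *\<^sub>R f (fst i) - integral (I i) f))"
        unfolding sum_distrib_left by (intro sum_mono step)
      also have "\<dots> = (\<Sum>(x,k)\<in>p. norm (measure lborel k *\<^sub>R f x - integral k f))"
        unfolding p_def by (subst sum.reindex[OF inj]) simp
      also have "\<dots> < e * \<eta>" by (rule hen[OF tag fine])
      finally show ?thesis using e by simp
    qed
    have U: "(\<Union>i\<in>C. I i) \<in> lmeasurable"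
      by (rule fmeasurable_UN_bound[OF C(1) I_meas bound])
    have mU: "measure lebesgue (\<Union>i\<in>C. I i) \<le> \<eta>"
      by (rule measure_UN_bound[OF C(1) I_meas bound])
    have N: "E e - (\<Union>i \<in> C. I i) \<in> lmeasurable" "measure lebesgue (E e - (\<Union>i \<in> C. I i)) = 0"
      using C(4) by (auto simp: negligible_iff_measure)
    show "\<exists>T. E e \<subseteq> T \<and> T \<in> lmeasurable \<and> measure lebesgue T \<le> \<eta>"
    proof (intro exI conjI)
      let ?T = "(E e - (\<Union>i \<in> C. I i)) \<union> (\<Union>i\<in>C. I i)"
      show "E e \<subseteq> ?T" by blast
      show "?T \<in> lmeasurable" using N U by blast
      show "measure lebesgue ?T \<le> \<eta>"
        using measure_Un_le[of "E e - (\<Union>i \<in> C. I i)" lebesgue "\<Union>i\<in>C. I i"] N U mU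
        by (auto simp: fmeasurableD)
    qed
  qed
  have "{x\<in>{a..b}. \<not> (F has_real_derivative f x) (at x within {a..b})} \<subseteq> (\<Union>n. E (1 / Suc n))"
  proof
    fix x assume "x \<in> {x\<in>{a..b}. \<not> (F has_real_derivative f x) (at x within {a..b})}"
    then have x: "x \<in> {a..b}" and nd: "\<not> ((\<lambda>y. (F y - F x) / (y - x)) \<longlongrightarrow> f x) (at x within {a..b})"
      by (auto simp: has_field_derivative_iff)
    from nd obtain e where e: "e > 0" and
      nd': "\<And>d. d > 0 \<Longrightarrow> \<exists>y\<in>{a..b}. y \<noteq> x \<and> dist y x < d \<and> e \<le> dist ((F y - F x) / (y - x)) (f x)"
      unfolding Lim_within by (force simp: not_less)
    obtain n where n: "1 / Suc n < e"
      using e reals_Archimedean by (metis inverse_eq_divide)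
    have "x \<in> E (1 / Suc n)"
      unfolding E_def
    proof (safe intro!: x)
      fix d :: real assume "d > 0"
      from nd'[OF this] obtain y where y: "y \<in> {a..b}" "y \<noteq> x" "dist y x < d"
        "e \<le> \<bar>(F y - F x) / (y - x) - f x\<bar>" by (auto simp: dist_real_def)
      have "(1 / Suc n) * \<bar>y - x\<bar> \<le> \<bar>(F y - F x) / (y - x) - f x\<bar> * \<bar>y - x\<bar>"
        using y n by (intro mult_right_mono) auto
      also have "\<dots> = \<bar>F y - F x - f x * (y - x)\<bar>"
        using y(2) by (simp add: abs_mult[symmetric] field_simps)
      finally show "\<exists>y\<in>{a..b}. y \<noteq> x \<and> \<bar>y - x\<bar> < d \<and> 1 / real (Suc n) * \<bar>y - x\<bar> \<le> \<bar>F y - F x - f x * (y - x)\<bar>"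
        using y by (auto simp: dist_real_def)
    qed
    then show "x \<in> (\<Union>n. E (1 / Suc n))" by blast
  qed
  moreover have "negligible (\<Union>n. E (1 / Suc n))"
    by (rule negligible_countable_Union) (auto intro: neg)
  ultimately show ?thesis
    unfolding F_def using negligible_subset by blast
qed

section \<open>Integrals over the half-line that depend on a parameter\<close>

text \<open>
  Differentiation under the integral sign by dominated convergence. A Lipschitz bound replaces a bound on
  the derivative because the kernels below have a corner at \<open>t = y\<close>, a point that moves with the
  parameter and therefore must be allowed to be an exceptional null set.
\<close>
lemma has_field_derivative_integral_Lipschitz:
  fixes \<kappa> :: "real \<Rightarrow> 't \<Rightarrow> real"
  assumes x: "x \<in> S"
    and int: "\<And>y. y \<in> S \<Longrightarrow> integrable M (\<kappa> y)"
    and h: "integrable M h"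
    and lip: "\<And>y t. y \<in> S \<Longrightarrow> t \<in> space M \<Longrightarrow> \<bar>\<kappa> y t - \<kappa> x t\<bar> \<le> h t * \<bar>y - x\<bar>"
    and der: "AE t in M. ((\<lambda>y. \<kappa> y t) has_real_derivative \<kappa>' t) (at x within S)"
    and meas: "\<kappa>' \<in> borel_measurable M"
  shows "((\<lambda>y. \<integral>t. \<kappa> y t \<partial>M) has_real_derivative (\<integral>t. \<kappa>' t \<partial>M)) (at x within S)"
  unfolding has_field_derivative_iff tendsto_at_iff_sequentially comp_def
proof (intro allI impI)
  fix Y :: "nat \<Rightarrow> real" assume Y: "\<forall>i. Y i \<in> S - {x}" and lim: "Y \<longlonglongrightarrow> x"
  have "(\<lambda>i. \<integral>t. (\<kappa> (Y i) t - \<kappa> x t) / (Y i - x) \<partial>M) \<longlonglongrightarrow> (\<integral>t. \<kappa>' t \<partial>M)"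
  proof (rule integral_dominated_convergence[where w = h])
    show "AE t in M. (\<lambda>i. (\<kappa> (Y i) t - \<kappa> x t) / (Y i - x)) \<longlonglongrightarrow> \<kappa>' t"
      using der by eventually_elim
        (use Y lim in \<open>auto simp: has_field_derivative_iff tendsto_at_iff_sequentially comp_def\<close>)
    show "AE t in M. norm ((\<kappa> (Y i) t - \<kappa> x t) / (Y i - x)) \<le> h t" for i
      using Y lip[of "Y i"] by (intro AE_I2) (auto simp: abs_divide divide_le_eq)
    show "(\<lambda>t. (\<kappa> (Y i) t - \<kappa> x t) / (Y i - x)) \<in> borel_measurable M" for i
      using int[of "Y i"] int[OF x] Y by (intro borel_measurable_divide borel_measurable_diff) auto
  qed (use h meas in auto)
  moreover have "(\<integral>t. (\<kappa> (Y i) t - \<kappa> x t) / (Y i - x) \<partial>M)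
      = ((\<integral>t. \<kappa> (Y i) t \<partial>M) - (\<integral>t. \<kappa> x t \<partial>M)) / (Y i - x)" for i
    using Y int x by (simp add: Bochner_Integration.integral_diff)
  ultimately show "(\<lambda>i. ((\<integral>t. \<kappa> (Y i) t \<partial>M) - (\<integral>t. \<kappa> x t \<partial>M)) / (Y i - x)) \<longlonglongrightarrow> (\<integral>t. \<kappa>' t \<partial>M)"
    by (simp only:)
qed

lemma continuous_on_integral_dominated:
  fixes f :: "'z::{first_countable_topology, t2_space} \<Rightarrow> 't \<Rightarrow> real"
  assumes meas: "\<And>z. f z \<in> borel_measurable M"
    and cont: "\<And>t. t \<in> space M \<Longrightarrow> continuous_on UNIV (\<lambda>z. f z t)"
    and dom: "\<And>a. \<exists>w. integrable M w \<and> (\<forall>\<^sub>F z in nhds a. \<forall>t\<in>space M. \<bar>f z t\<bar> \<le> w t)"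
  shows "continuous_on UNIV (\<lambda>z. \<integral>t. f z t \<partial>M)"
proof (rule continuous_on_sequentiallyI)
  fix u :: "nat \<Rightarrow> 'z" and a assume u: "u \<longlonglongrightarrow> a"
  from dom[of a] obtain w where w: "integrable M w"
    and ev: "\<forall>\<^sub>F z in nhds a. \<forall>t\<in>space M. \<bar>f z t\<bar> \<le> w t" by blast
  from filterlim_iff[THEN iffD1, OF u, rule_format, OF ev]
  obtain N where N: "\<And>n t. N \<le> n \<Longrightarrow> t \<in> space M \<Longrightarrow> \<bar>f (u n) t\<bar> \<le> w t"
    by (auto simp: eventually_sequentially)
  show "(\<lambda>n. \<integral>t. f (u n) t \<partial>M) \<longlonglongrightarrow> (\<integral>t. f a t \<partial>M)"
  proof (rule LIMSEQ_offset[of _ N], rule integral_dominated_convergence[OF meas meas w])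
    show "AE t in M. (\<lambda>n. f (u (n + N)) t) \<longlonglongrightarrow> f a t"
    proof (rule AE_I2)
      fix t assume "t \<in> space M"
      from continuous_on_tendsto_compose[OF cont[OF this] u] have "(\<lambda>n. f (u n) t) \<longlonglongrightarrow> f a t" by simp
      then show "(\<lambda>n. f (u (n + N)) t) \<longlonglongrightarrow> f a t" by (rule LIMSEQ_ignore_initial_segment)
    qed
    show "AE t in M. norm (f (u (n + N)) t) \<le> w t" for n
      using N by (intro AE_I2) auto
  qed
qed

lemma AE_Rplus_neq: "AE t in Rplus. t \<noteq> (x::real)"
proof -
  have "AE t in lebesgue. t \<noteq> x"
    by (rule AE_I[where N = "{x}"]) auto
  then show ?thesis by (auto simp: AE_restrict_space_iff elim: eventually_mono)
qed

lemma measurable_Rplus_indicator [measurable]: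
  "(\<lambda>t. indicator {x<..} t :: real) \<in> borel_measurable Rplus"
  by (intro measurable_restrict_space1 measurable_completion borel_measurable_indicator) simp

lemma continuous_imp_measurable_Rplus:
  fixes f :: "real \<Rightarrow> 'b::real_normed_vector"
  assumes "continuous_on UNIV f"
  shows "f \<in> borel_measurable Rplus"
  using borel_measurable_continuous_onI[OF assms]
  by (intro measurable_restrict_space1) (simp add: measurable_completion)

lemma integrable_Rplus_mult_bounded:
  fixes f h :: "real \<Rightarrow> real"
  assumes h: "integrable Rplus h" and f: "f \<in> borel_measurable Rplus"
    and b: "\<And>t. t > 0 \<Longrightarrow> \<bar>f t\<bar> \<le> C"
  shows "integrable Rplus (\<lambda>t. f t * h t)"
proof (rule Bochner_Integration.integrable_bound[where f = "\<lambda>t. C * h t"])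
  show "integrable Rplus (\<lambda>t. C * h t)" using h by simp
  have "(\<lambda>t. f t * h t) \<in> borel_measurable Rplus" using h f by measurable
  then show "(\<lambda>t. f t * h t) \<in> borel_measurable Rplus" .
  have "C \<ge> 0" using b[of 1] by simp
  then show "AE t in Rplus. norm (f t * h t) \<le> norm (C * h t)"
    by (intro AE_I2) (auto simp: abs_mult intro!: mult_right_mono b)
qed

lemma integrable_Rplus_tail:
  fixes h :: "real \<Rightarrow> real"
  assumes "integrable Rplus h"
  shows "integrable Rplus (\<lambda>t. indicator {x<..} t * h t)"
  by (rule integrable_Rplus_mult_bounded[OF assms measurable_Rplus_indicator, where C = 1])
    (auto simp: indicator_def)

lemma tail_integral_tendsto_0:
  fixes g :: "real \<Rightarrow> real"
  assumes "integrable Rplus g"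
  shows "((\<lambda>x. \<integral>t. indicator {x<..} t * g t \<partial>Rplus) \<longlongrightarrow> 0) at_top"
proof -
  have "((\<lambda>x. \<integral>t. indicator {x<..} t * g t \<partial>Rplus) \<longlongrightarrow> (\<integral>t. 0 \<partial>Rplus)) at_top"
  proof (rule integral_dominated_convergence_at_top[where w = "\<lambda>t. \<bar>g t\<bar>"])
    show "AE t in Rplus. ((\<lambda>x. indicator {x<..} t * g t) \<longlongrightarrow> 0) at_top"
    proof (rule AE_I2)
      fix t :: real
      have "\<forall>\<^sub>F x in at_top. indicator {x<..} t * g t = 0"
        using eventually_ge_at_top[of t] by eventually_elim auto
      then show "((\<lambda>x. indicator {x<..} t * g t) \<longlongrightarrow> 0) at_top"
        by (rule tendsto_eventually)
    qed
    show "(\<lambda>t. indicator {x<..} t * g t) \<in> borel_measurable Rplus" for x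
      using integrable_Rplus_tail[OF assms] by simp
    show "\<forall>\<^sub>F x in at_top. AE t in Rplus. norm (indicator {x<..} t * g t) \<le> \<bar>g t\<bar>"
      by (auto simp: indicator_def)
  qed (use assms in auto)
  then show ?thesis by simp
qed

lemma has_real_derivative_eventually_eq:
  assumes "(f has_real_derivative D) (at x)" and "\<forall>\<^sub>F y in nhds x. f y = g y"
  shows "(g has_real_derivative D) (at x)"
  using assms(1) DERIV_cong_ev[OF refl assms(2) refl, of D] by simp

lemma AE_Rplus_pos: "AE x in Rplus. x > 0"
  by (rule AE_I2) simp

text \<open>
  Lebesgue differentiation on each interval \<open>[0, R]\<close> with \<open>R\<close> a natural number; the exceptional sets
  form a countable union.
\<close>
lemma tail_integral_has_derivative_AE:
  fixes h :: "real \<Rightarrow> real"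
  assumes h: "integrable Rplus h"
  shows "AE x in Rplus. ((\<lambda>x. \<integral>t. indicator {x<..} t * h t \<partial>Rplus) has_real_derivative - h x) (at x)"
proof -
  define h0 where "h0 = (\<lambda>t. indicator {0<..} t * h t)"
  have h0: "integrable lebesgue h0"
    using h by (simp add: integrable_restrict_space h0_def)
  define F where "F = (\<lambda>y. integral {0..y} h0)"
  define Tl where "Tl = (\<lambda>x. \<integral>t. indicator {x<..} t * h t \<partial>Rplus)"
  have Tl: "Tl y = Tl 0 - F y" if "y \<ge> 0" for y
  proof -
    have "Tl 0 - Tl y = (\<integral>t. indicator {0<..} t * h t - indicator {y<..} t * h t \<partial>Rplus)"
      unfolding Tl_def by (intro Bochner_Integration.integral_diff[symmetric] integrable_Rplus_tail h)
    also have "\<dots> = (\<integral>t. indicator {0<..} t *\<^sub>R (indicator {0<..} t * h t - indicator {y<..} t * h t) \<partial>lebesgue)"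
      by (rule integral_restrict_space) simp
    also have "\<dots> = (\<integral>t. indicator {0..y} t *\<^sub>R h0 t \<partial>lebesgue)"
      using that by (intro Bochner_Integration.integral_cong) (auto simp: h0_def indicator_def)
    also have "\<dots> = F y"
      unfolding F_def set_lebesgue_integral_def[symmetric]
    proof (rule set_lebesgue_integral_eq_integral)
      show "set_integrable lebesgue {0..y} h0"
        unfolding set_integrable_def using h0 by (intro integrable_mult_indicator) auto
    qed
    finally show ?thesis by simp
  qed
  define N where "N = (\<lambda>R::nat. {x\<in>{0..real R}. \<not> (F has_real_derivative h0 x) (at x within {0..real R})})"
  have "negligible (N R)" for R
    unfolding N_def F_def
  proof (rule negligible_Lebesgue_nondifferentiable)
    have "set_integrable lebesgue {0..real R} h0"
      unfolding set_integrable_def using h0 by (intro integrable_mult_indicator) auto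
    then show "h0 integrable_on {0..real R}" by (rule set_lebesgue_integral_eq_integral(1))
  qed
  then have "negligible (\<Union>R. N R)" by (intro negligible_countable_Union) auto
  then have "(\<Union>R. N R) \<in> null_sets lebesgue" by (simp add: negligible_iff_null_sets)
  then have "AE x in lebesgue. x \<notin> (\<Union>R. N R)" by (rule AE_not_in)
  then have "AE x in Rplus. x \<notin> (\<Union>R. N R)"
    by (auto simp: AE_restrict_space_iff elim: eventually_mono)
  moreover note AE_Rplus_pos
  ultimately have "AE x in Rplus. (Tl has_real_derivative - h x) (at x)"
  proof eventually_elim
    case (elim x)
    obtain R :: nat where R: "x < real R" using reals_Archimedean2 by blast
    with elim have "(F has_real_derivative h0 x) (at x within {0..real R})" by (auto simp: N_def)
    moreover have "at x within {0..real R} = at x"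
      using elim R by (intro at_within_interior) auto
    ultimately have "(F has_real_derivative h x) (at x)" using elim by (simp add: h0_def)
    then have "((\<lambda>y. Tl 0 - F y) has_real_derivative - h x) (at x)"
      by (auto intro!: derivative_eq_intros)
    moreover have "\<forall>\<^sub>F y in nhds x. Tl 0 - F y = Tl y"
      using eventually_nhds_in_open[of "{0<..}" x] elim(2) by (auto elim!: eventually_mono intro!: Tl[symmetric])
    ultimately show ?case by (rule has_real_derivative_eventually_eq)
  qed
  then show ?thesis by (simp add: Tl_def)
qed

section \<open>The Green function of the Volterra equation\<close>

text \<open>
  The value at 0 fills the removable singularity, which makes the kernel below continuous at zero energy.
\<close>
definition exp_quotient :: "real \<Rightarrow> real" where
  "exp_quotient z = (if z = 0 then 1 else (1 - exp (- z)) / z)"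

lemma isCont_exp_quotient: "isCont exp_quotient z"
proof (cases "z = 0")
  case True
  have "((\<lambda>z. - exp (- z)) has_real_derivative 1) (at (0::real))"
    by (auto intro!: derivative_eq_intros)
  then have "((\<lambda>z::real. (1 - exp (- z)) / z) \<longlongrightarrow> 1) (at 0)"
    by (simp add: has_field_derivative_iff)
  then have "(exp_quotient \<longlongrightarrow> 1) (at 0)"
    by (rule Lim_transform_within[where d = 1]) (auto simp: exp_quotient_def)
  then show ?thesis using True by (simp add: isCont_def exp_quotient_def)
next
  case False
  have "isCont (\<lambda>z. (1 - exp (- z)) / z) z" using False by (intro continuous_intros) auto
  moreover have "\<forall>\<^sub>F w in nhds z. exp_quotient w = (1 - exp (- w)) / w"
    using t1_space_nhds[OF False] by eventually_elim (auto simp: exp_quotient_def)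
  ultimately show ?thesis using isCont_cong by fast
qed

lemma continuous_on_exp_quotient [continuous_intros]:
  "continuous_on S f \<Longrightarrow> continuous_on S (\<lambda>x. exp_quotient (f x))"
  by (rule continuous_on_compose2[of UNIV exp_quotient])
    (auto simp: continuous_on_eq_continuous_at isCont_exp_quotient)

text \<open>
  For \<open>a > 0\<close> this is \<open>(1 - e\<^bsup>-ay\<^esup>)/a\<close> on \<open>y \<ge> 0\<close>, for \<open>a = 0\<close> it is \<open>y\<close>, and it vanishes for negative
  \<open>y\<close>. As a function of \<open>x\<close>, the kernel \<open>green a (t - x)\<close> is the fundamental solution of
  \<open>u'' - a u'\<close> with pole \<open>t\<close> that is supported in \<open>x \<le> t\<close>. This is the operator that remains of
  \<open>f'' - k\<^sup>2 f\<close> after substituting \<open>f = e\<^bsup>-kx\<^esup> u\<close>, with \<open>a = 2k\<close>.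
\<close>
definition green :: "real \<Rightarrow> real \<Rightarrow> real" where
  "green a y = max y 0 * exp_quotient (a * max y 0)"

lemma continuous_on_green [continuous_intros]:
  "continuous_on S f \<Longrightarrow> continuous_on S g \<Longrightarrow> continuous_on S (\<lambda>x. green (f x) (g x))"
  unfolding green_def by (intro continuous_intros)

lemma green_nonpos: "y \<le> 0 \<Longrightarrow> green a y = 0"
  by (simp add: green_def)

lemma green_0: "green 0 y = max y 0"
  by (simp add: green_def exp_quotient_def)

lemma green_pos: "a > 0 \<Longrightarrow> y \<ge> 0 \<Longrightarrow> green a y = (1 - exp (- a * y)) / a"
  by (simp add: green_def exp_quotient_def)

lemma green_has_derivative:
  assumes "a \<ge> 0" "y \<noteq> 0"
  shows "(green a has_real_derivative (if y > 0 then exp (- a * y) else 0)) (at y)"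
proof (cases "y > 0")
  case True
  define f where "f = (\<lambda>y. if a = 0 then y else (1 - exp (- a * y)) / a)"
  have "(f has_real_derivative exp (- a * y)) (at y)"
    by (cases "a = 0") (auto simp: f_def intro!: derivative_eq_intros)
  moreover have "\<forall>\<^sub>F w in nhds y. f w = green a w"
    using eventually_nhds_in_open[of "{0<..}" y] True
    by (auto elim!: eventually_mono simp: f_def green_0 green_pos assms less_le)
  ultimately show ?thesis
    using True has_real_derivative_eventually_eq by fastforce
next
  case False
  have "\<forall>\<^sub>F w in nhds y. (0::real) = green a w"
    using eventually_nhds_in_open[of "{..<0}" y] False assms
    by (auto elim!: eventually_mono simp: green_nonpos)
  moreover have "((\<lambda>_. 0) has_real_derivative 0) (at y)" by simp
  ultimately show ?thesis
    using False has_real_derivative_eventually_eq by fastforce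
qed

text \<open>
  The constant 1 does not depend on \<open>a\<close>; all estimates that are uniform down to zero energy come from it.
\<close>
lemma green_Lipschitz:
  assumes a: "a \<ge> 0"
  shows "\<bar>green a y - green a z\<bar> \<le> \<bar>y - z\<bar>"
proof -
  have *: "0 \<le> green a y - green a z \<and> green a y - green a z \<le> y - z" if "0 \<le> z" "z \<le> y" for y z
  proof (cases "a = 0")
    case True
    then show ?thesis using that by (simp add: green_0)
  next
    case False
    then have "a > 0" using a by simp
    have eq: "green a y - green a z = exp (- a * z) * (1 - exp (- a * (y - z))) / a"
      using \<open>a > 0\<close> that by (simp add: green_pos field_simps exp_add[symmetric])
    have "1 - exp (- a * (y - z)) \<le> a * (y - z)"
      using exp_ge_add_one_self[of "- a * (y - z)"] by simp
    moreover have "0 \<le> 1 - exp (- a * (y - z))" "exp (- a * z) \<le> 1" "0 \<le> a * (y - z)"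
      using that a by simp_all
    ultimately have "exp (- a * z) * (1 - exp (- a * (y - z))) \<le> 1 * (a * (y - z))"
      by (intro mult_mono) auto
    then show ?thesis
      unfolding eq using \<open>a > 0\<close> \<open>0 \<le> 1 - exp (- a * (y - z))\<close> by (simp add: divide_le_eq mult.commute)
  qed
  have "green a y = green a (max y 0)" "green a z = green a (max z 0)" by (simp_all add: green_def)
  then show ?thesis
    using *[of "max z 0" "max y 0"] *[of "max y 0" "max z 0"] by (smt (verit))
qed

lemma green_nonneg:
  assumes a: "a \<ge> 0"
  shows "0 \<le> green a y"
proof -
  have "0 \<le> exp_quotient z" if "z \<ge> 0" for z using that by (auto simp: exp_quotient_def)
  then show ?thesis using a by (simp add: green_def)
qed

lemma green_le: "a \<ge> 0 \<Longrightarrow> green a y \<le> max y 0"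
  using green_Lipschitz[of a y 0] green_nonneg[of a y] green_nonpos[of y a]
  by (cases "y \<le> 0") (auto simp: green_def[of a 0])

lemma green_le_inverse: "a > 0 \<Longrightarrow> green a y \<le> 1 / a"
  by (cases "y \<le> 0") (auto simp: green_nonpos green_pos divide_right_mono)

lemma measurable_green_Rplus [measurable]:
  "(\<lambda>t. green a (t - x)) \<in> borel_measurable Rplus"
  by (rule continuous_imp_measurable_Rplus) (intro continuous_intros)

lemma integrable_green:
  assumes a: "a \<ge> 0" and h: "integrable Rplus h" and th: "integrable Rplus (\<lambda>t. t * h t)"
  shows "integrable Rplus (\<lambda>t. green a (t - x) * h t)"
proof (rule Bochner_Integration.integrable_bound[where f = "\<lambda>t. \<bar>t * h t\<bar> + \<bar>x\<bar> * \<bar>h t\<bar>"])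
  show "integrable Rplus (\<lambda>t. \<bar>t * h t\<bar> + \<bar>x\<bar> * \<bar>h t\<bar>)" using h th by (intro integrable_abs Bochner_Integration.integrable_add Bochner_Integration.integrable_mult_right) auto
  show "(\<lambda>t. green a (t - x) * h t) \<in> borel_measurable Rplus" using h by measurable
  show "AE t in Rplus. norm (green a (t - x) * h t) \<le> norm (\<bar>t * h t\<bar> + \<bar>x\<bar> * \<bar>h t\<bar>)"
  proof (rule AE_I2)
    fix t assume "t \<in> space Rplus"
    then have "t > 0" by simp
    have "\<bar>green a (t - x) * h t\<bar> \<le> max (t - x) 0 * \<bar>h t\<bar>"
      using green_nonneg[OF a] green_le[OF a] by (simp add: abs_mult mult_right_mono)
    also have "\<dots> \<le> (t + \<bar>x\<bar>) * \<bar>h t\<bar>" using \<open>t > 0\<close> by (intro mult_right_mono) auto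
    finally show "norm (green a (t - x) * h t) \<le> norm (\<bar>t * h t\<bar> + \<bar>x\<bar> * \<bar>h t\<bar>)"
      using \<open>t > 0\<close> by (simp add: abs_mult algebra_simps)
  qed
qed

lemma green_integral_has_derivative:
  assumes a: "a \<ge> 0" and h: "integrable Rplus h" and th: "integrable Rplus (\<lambda>t. t * h t)"
  shows "((\<lambda>x. \<integral>t. green a (t - x) * h t \<partial>Rplus) has_real_derivative
     - (\<integral>t. indicator {x<..} t * (exp (- a * (t - x)) * h t) \<partial>Rplus)) (at x)"
proof -
  have [measurable]: "(\<lambda>t. exp (- a * (t - x))) \<in> borel_measurable Rplus"
    by (rule continuous_imp_measurable_Rplus) (intro continuous_intros)
  have [measurable]: "h \<in> borel_measurable Rplus" using h by simp
  have "((\<lambda>x. \<integral>t. green a (t - x) * h t \<partial>Rplus) has_real_derivative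
     (\<integral>t. - (indicator {x<..} t * (exp (- a * (t - x)) * h t)) \<partial>Rplus)) (at x)"
  proof (rule has_field_derivative_integral_Lipschitz[where h = "\<lambda>t. \<bar>h t\<bar>"])
    show "\<bar>green a (t - y) * h t - green a (t - x) * h t\<bar> \<le> \<bar>h t\<bar> * \<bar>y - x\<bar>" for y t
    proof -
      have "\<bar>green a (t - y) * h t - green a (t - x) * h t\<bar> = \<bar>h t\<bar> * \<bar>green a (t - y) - green a (t - x)\<bar>"
        by (simp add: left_diff_distrib[symmetric] abs_mult)
      also have "\<dots> \<le> \<bar>h t\<bar> * \<bar>y - x\<bar>"
        using green_Lipschitz[OF a, of "t - y" "t - x"] by (intro mult_left_mono) auto
      finally show ?thesis .
    qed
    show "AE t in Rplus. ((\<lambda>y. green a (t - y) * h t) has_real_derivative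
        - (indicator {x<..} t * (exp (- a * (t - x)) * h t))) (at x)"
      using AE_Rplus_neq[of x]
    proof eventually_elim
      case (elim t)
      have "((\<lambda>y. green a (t - y)) has_real_derivative
          (if t - x > 0 then exp (- a * (t - x)) else 0) * (0 - 1)) (at x)"
        by (rule DERIV_chain2[OF green_has_derivative[OF a]])
          (use elim in \<open>auto intro!: derivative_eq_intros\<close>)
      from DERIV_cmult_right[OF this, of "h t"] show ?case
        by (auto simp: indicator_def split: if_splits)
    qed
    show "integrable Rplus (\<lambda>t. green a (t - y) * h t)" for y
      by (rule integrable_green[OF assms])
    show "(\<lambda>t. - (indicator {x<..} t * (exp (- a * (t - x)) * h t))) \<in> borel_measurable Rplus"
      by measurable
  qed (use h in auto)
  then show ?thesis by simp
qed

text \<open>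
  Bounding the kernel by \<open>t\<close> on \<open>t > x\<close> shows decay at infinity, uniformly in \<open>a\<close>. This is where a
  finite first moment of \<open>h\<close> enters.
\<close>
lemma green_integral_le_tail:
  assumes a: "a \<ge> 0" and h: "integrable Rplus h" and th: "integrable Rplus (\<lambda>t. t * h t)"
    and x: "x \<ge> 0"
  shows "\<bar>\<integral>t. green a (t - x) * h t \<partial>Rplus\<bar> \<le> (\<integral>t. indicator {x<..} t * (t * \<bar>h t\<bar>) \<partial>Rplus)"
proof -
  have th': "integrable Rplus (\<lambda>t. t * \<bar>h t\<bar>)"
  proof -
    have "integrable Rplus (\<lambda>t. \<bar>t * h t\<bar>)" using th by (rule integrable_abs)
    then show ?thesis
      by (rule Bochner_Integration.integrable_cong[THEN iffD1, rotated -1]) (auto simp: abs_mult)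
  qed
  have "\<bar>\<integral>t. green a (t - x) * h t \<partial>Rplus\<bar> \<le> (\<integral>t. \<bar>green a (t - x) * h t\<bar> \<partial>Rplus)"
    by (rule integral_abs_bound)
  also have "\<dots> \<le> (\<integral>t. indicator {x<..} t * (t * \<bar>h t\<bar>) \<partial>Rplus)"
  proof (rule integral_mono)
    show "integrable Rplus (\<lambda>t. \<bar>green a (t - x) * h t\<bar>)"
      by (rule integrable_abs, rule integrable_green[OF a h th])
    show "integrable Rplus (\<lambda>t. indicator {x<..} t * (t * \<bar>h t\<bar>))"
      by (rule integrable_Rplus_tail[OF th'])
    fix t assume "t \<in> space Rplus"
    then have "t > 0" by simp
    have "\<bar>green a (t - x) * h t\<bar> \<le> max (t - x) 0 * \<bar>h t\<bar>"
      using green_nonneg[OF a] green_le[OF a] by (simp add: abs_mult mult_right_mono)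
    also have "\<dots> \<le> (indicator {x<..} t * t) * \<bar>h t\<bar>"
      using \<open>t > 0\<close> x by (intro mult_right_mono) (auto simp: indicator_def)
    finally show "\<bar>green a (t - x) * h t\<bar> \<le> indicator {x<..} t * (t * \<bar>h t\<bar>)"
      by (simp add: mult.assoc)
  qed
  finally show ?thesis .
qed

lemma green_integral_tendsto_0:
  assumes h: "integrable Rplus h" and th: "integrable Rplus (\<lambda>t. t * h t)" and h0: "\<And>t. h t \<ge> 0"
  shows "((\<lambda>x. \<integral>t. green 0 (t - x) * h t \<partial>Rplus) \<longlongrightarrow> 0) at_top"
proof (rule Lim_null_comparison)
  show "\<forall>\<^sub>F x in at_top. norm (\<integral>t. green 0 (t - x) * h t \<partial>Rplus) \<le> (\<integral>t. indicator {x<..} t * (t * h t) \<partial>Rplus)"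
    using eventually_ge_at_top[of 0]
    by eventually_elim (use green_integral_le_tail[OF order_refl h th] h0 in simp)
qed (rule tail_integral_tendsto_0[OF th])

section \<open>Existence of the Jost solutions\<close>
locale half_line_potential =
  fixes q :: "real \<Rightarrow> real"
  assumes q_int: "integrable Rplus q"
    and tq_int: "integrable Rplus (\<lambda>t. t * q t)"
begin

lemma abs_q_int: "integrable Rplus (\<lambda>t. \<bar>q t\<bar>)"
  using q_int by (rule integrable_abs)

lemma t_abs_q_int: "integrable Rplus (\<lambda>t. t * \<bar>q t\<bar>)"
proof -
  have "integrable Rplus (\<lambda>t. \<bar>t * q t\<bar>)" using tq_int by (rule integrable_abs)
  then show ?thesis
    by (rule Bochner_Integration.integrable_cong[THEN iffD1, rotated -1]) (auto simp: abs_mult)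
qed

definition moment :: "real \<Rightarrow> real" where
  "moment x = (\<integral>t. green 0 (t - x) * \<bar>q t\<bar> \<partial>Rplus)"

text \<open>
  The contraction argument takes place in the supremum norm with this weight. Since
  \<open>moment'(x) = - \<integral>\<^bsub>t>x\<^esub> |q|\<close>, the weight dominates the growth that iterating the Volterra kernel can
  produce, and the factor 2 in the exponent yields the contraction constant \<open>1/2\<close>.
\<close>
definition weight :: "real \<Rightarrow> real" where
  "weight x = exp (2 * moment x)"

definition weighted_moment :: "real \<Rightarrow> real" where
  "weighted_moment x = (\<integral>t. green 0 (t - x) * (weight t * \<bar>q t\<bar>) \<partial>Rplus)"

lemma moment_has_derivative:
  "(moment has_real_derivative - (\<integral>t. indicator {x<..} t * \<bar>q t\<bar> \<partial>Rplus)) (at x)"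
  using green_integral_has_derivative[OF order_refl abs_q_int t_abs_q_int, of x]
  unfolding moment_def by simp

lemma weight_has_derivative:
  "(weight has_real_derivative - (2 * weight x * (\<integral>t. indicator {x<..} t * \<bar>q t\<bar> \<partial>Rplus))) (at x)"
  unfolding weight_def[abs_def]
  by (rule derivative_eq_intros moment_has_derivative refl)+ simp

lemma continuous_weight: "continuous_on S weight"
  using weight_has_derivative DERIV_isCont by (blast intro: continuous_at_imp_continuous_on)

lemma measurable_weight [measurable]: "weight \<in> borel_measurable Rplus"
  by (rule continuous_imp_measurable_Rplus[OF continuous_weight])

lemma moment_antimono: "x \<le> y \<Longrightarrow> moment y \<le> moment x"
  unfolding moment_def
  by (intro integral_mono integrable_green abs_q_int t_abs_q_int mult_right_mono) (auto simp: green_0)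

lemma weight_antimono: "x \<le> y \<Longrightarrow> weight y \<le> weight x"
  by (simp add: weight_def moment_antimono)

lemma weight_pos: "weight x > 0"
  by (simp add: weight_def)

lemma moment_nonneg: "moment x \<ge> 0"
  unfolding moment_def by (intro Bochner_Integration.integral_nonneg) (simp add: green_nonneg)

lemma weight_ge_1: "weight x \<ge> 1"
  using moment_nonneg[of x] by (simp add: weight_def)

lemma weight_abs_q_int: "integrable Rplus (\<lambda>t. weight t * \<bar>q t\<bar>)"
  by (rule integrable_Rplus_mult_bounded[OF abs_q_int measurable_weight, where C = "weight 0"])
    (use weight_antimono[of 0] weight_pos in \<open>auto simp: less_imp_le\<close>)

lemma t_weight_abs_q_int: "integrable Rplus (\<lambda>t. t * (weight t * \<bar>q t\<bar>))"
proof -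
  have "integrable Rplus (\<lambda>t. weight t * (t * \<bar>q t\<bar>))"
    by (rule integrable_Rplus_mult_bounded[OF t_abs_q_int measurable_weight, where C = "weight 0"])
      (use weight_antimono[of 0] weight_pos in \<open>auto simp: less_imp_le\<close>)
  then show ?thesis by (simp add: mult.left_commute)
qed

lemma weighted_moment_has_derivative:
  "(weighted_moment has_real_derivative - (\<integral>t. indicator {x<..} t * (weight t * \<bar>q t\<bar>) \<partial>Rplus)) (at x)"
  using green_integral_has_derivative[OF order_refl weight_abs_q_int t_weight_abs_q_int, of x]
  unfolding weighted_moment_def by simp

text \<open>
  The key estimate for the contraction. Differentiating, and using that the weight decreases,
  \<open>weighted_moment' = - \<integral>\<^bsub>t>x\<^esub> weight |q| \<ge> - weight \<integral>\<^bsub>t>x\<^esub> |q| = (weight / 2)'\<close>. So the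
  difference \<open>weighted_moment - weight / 2\<close> increases, and its limit at infinity is \<open>- 1/2\<close>.
\<close>
lemma weighted_moment_le: "weighted_moment x \<le> (weight x - 1) / 2"
proof -
  define D where "D = (\<lambda>x. weighted_moment x - weight x / 2)"
  have mono: "D x \<le> D y" if "x \<le> y" for y
  proof (rule DERIV_nonneg_imp_nondecreasing[OF that])
    fix z
    let ?d = "weight z * (\<integral>t. indicator {z<..} t * \<bar>q t\<bar> \<partial>Rplus) - (\<integral>t. indicator {z<..} t * (weight t * \<bar>q t\<bar>) \<partial>Rplus)"
    have "(D has_real_derivative ?d) (at z)"
      unfolding D_def
      by (auto intro!: derivative_eq_intros weighted_moment_has_derivative weight_has_derivative)
    moreover have "(\<integral>t. indicator {z<..} t * (weight t * \<bar>q t\<bar>) \<partial>Rplus) \<le> (\<integral>t. weight z * (indicator {z<..} t * \<bar>q t\<bar>) \<partial>Rplus)"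
    proof (rule integral_mono)
      show "integrable Rplus (\<lambda>t. indicator {z<..} t * (weight t * \<bar>q t\<bar>))"
        by (rule integrable_Rplus_tail[OF weight_abs_q_int])
      show "integrable Rplus (\<lambda>t. weight z * (indicator {z<..} t * \<bar>q t\<bar>))"
        by (intro Bochner_Integration.integrable_mult_right integrable_Rplus_tail[OF abs_q_int])
      show "indicator {z<..} t * (weight t * \<bar>q t\<bar>) \<le> weight z * (indicator {z<..} t * \<bar>q t\<bar>)" for t
        using weight_antimono[of z t] by (auto simp: indicator_def mult_right_mono)
    qed
    ultimately show "\<exists>d. (D has_real_derivative d) (at z) \<and> 0 \<le> d" by auto
  qed
  have "(weight \<longlongrightarrow> exp (2 * 0)) at_top"
    unfolding weight_def[abs_def] moment_def
    by (intro tendsto_intros green_integral_tendsto_0 abs_q_int t_abs_q_int) simp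
  moreover have "(weighted_moment \<longlongrightarrow> 0) at_top"
    unfolding weighted_moment_def[abs_def]
    by (intro green_integral_tendsto_0 weight_abs_q_int t_weight_abs_q_int) (simp add: weight_pos less_imp_le)
  ultimately have "(D \<longlongrightarrow> 0 - exp (2 * 0) / 2) at_top"
    unfolding D_def by (intro tendsto_intros) simp_all
  then have "D x \<le> 0 - exp (2 * 0) / 2"
    by (rule tendsto_lowerbound) (use mono in \<open>auto simp: eventually_at_top_linorder\<close>)
  then show ?thesis by (simp add: D_def)
qed

text \<open>
  The Volterra operator applied to \<open>weight g\<close>. Its argument is the pair \<open>(k, x)\<close>, and \<open>k\<close> enters by its
  absolute value, so that the fixed point argument can be run on functions on the whole plane.
\<close>
definition perturb :: "(real \<times> real \<Rightarrow> real) \<Rightarrow> real \<times> real \<Rightarrow> real" where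
  "perturb g z = (\<integral>t. green (2 * \<bar>fst z\<bar>) (t - snd z) * (q t * (weight t * g (fst z, t))) \<partial>Rplus)"

lemma perturb_integrable:
  assumes g: "continuous_on UNIV g" and b: "\<And>z. \<bar>g z\<bar> \<le> c"
  shows "integrable Rplus (\<lambda>t. q t * (weight t * g (k, t)))"
    and "integrable Rplus (\<lambda>t. t * (q t * (weight t * g (k, t))))"
proof -
  have [measurable]: "(\<lambda>t. g (k, t)) \<in> borel_measurable Rplus"
    by (rule continuous_imp_measurable_Rplus) (auto intro!: continuous_on_compose2[OF g] continuous_intros)
  have m: "(\<lambda>t. weight t * g (k, t)) \<in> borel_measurable Rplus" by measurable
  have bb: "\<bar>weight t * g (k, t)\<bar> \<le> weight 0 * c" if "t > 0" for t
    unfolding abs_mult using weight_pos[of t] weight_pos[of 0] weight_antimono[of 0 t] b that by (intro mult_mono) auto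
  from integrable_Rplus_mult_bounded[OF q_int m bb]
  show "integrable Rplus (\<lambda>t. q t * (weight t * g (k, t)))" by (simp add: mult.commute)
  from integrable_Rplus_mult_bounded[OF tq_int m bb]
  show "integrable Rplus (\<lambda>t. t * (q t * (weight t * g (k, t))))" by (simp add: mult_ac)
qed

lemma perturb_bound:
  assumes g: "continuous_on UNIV g" and b: "\<And>z. \<bar>g z\<bar> \<le> c"
  shows "\<bar>perturb g z\<bar> \<le> c * ((weight (snd z) - 1) / 2)"
proof -
  have c: "c \<ge> 0" using b[of undefined] by simp
  have "\<bar>perturb g z\<bar> \<le> (\<integral>t. \<bar>green (2 * \<bar>fst z\<bar>) (t - snd z) * (q t * (weight t * g (fst z, t)))\<bar> \<partial>Rplus)"
    unfolding perturb_def by (rule integral_abs_bound)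
  also have "\<dots> \<le> (\<integral>t. c * (green 0 (t - snd z) * (weight t * \<bar>q t\<bar>)) \<partial>Rplus)"
  proof (rule integral_mono)
    show "integrable Rplus (\<lambda>t. \<bar>green (2 * \<bar>fst z\<bar>) (t - snd z) * (q t * (weight t * g (fst z, t)))\<bar>)"
      by (intro integrable_abs integrable_green perturb_integrable[OF g b]) simp
    show "integrable Rplus (\<lambda>t. c * (green 0 (t - snd z) * (weight t * \<bar>q t\<bar>)))"
      by (intro Bochner_Integration.integrable_mult_right integrable_green weight_abs_q_int t_weight_abs_q_int) simp
    fix t
    have "\<bar>green (2 * \<bar>fst z\<bar>) (t - snd z) * (q t * (weight t * g (fst z, t)))\<bar>
        = green (2 * \<bar>fst z\<bar>) (t - snd z) * (weight t * \<bar>q t\<bar>) * \<bar>g (fst z, t)\<bar>"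
      using weight_pos[of t] by (simp add: abs_mult green_nonneg)
    also have "\<dots> \<le> (green 0 (t - snd z) * (weight t * \<bar>q t\<bar>)) * c"
      using weight_pos[of t] by (intro mult_mono b mult_right_mono) (auto simp: green_0 green_le green_nonneg)
    finally show "\<bar>green (2 * \<bar>fst z\<bar>) (t - snd z) * (q t * (weight t * g (fst z, t)))\<bar>
        \<le> c * (green 0 (t - snd z) * (weight t * \<bar>q t\<bar>))" by (simp add: mult_ac)
  qed
  also have "\<dots> = c * weighted_moment (snd z)" by (simp add: weighted_moment_def)
  also have "\<dots> \<le> c * ((weight (snd z) - 1) / 2)" by (intro mult_left_mono weighted_moment_le c)
  finally show ?thesis .
qed

lemma continuous_perturb:
  assumes g: "continuous_on UNIV g" and b: "\<And>z. \<bar>g z\<bar> \<le> c"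
  shows "continuous_on UNIV (perturb g)"
  unfolding perturb_def
proof (rule continuous_on_integral_dominated)
  have c: "c \<ge> 0" using b[of undefined] by simp
  show "(\<lambda>t. green (2 * \<bar>fst z\<bar>) (t - snd z) * (q t * (weight t * g (fst z, t)))) \<in> borel_measurable Rplus" for z
    by (intro borel_measurable_times measurable_green_Rplus borel_measurable_integrable perturb_integrable[OF g b])
  show "continuous_on UNIV (\<lambda>z. green (2 * \<bar>fst z\<bar>) (t - snd z) * (q t * (weight t * g (fst z, t))))" for t
    by (intro continuous_intros continuous_on_compose2[OF g]) auto
  fix a :: "real \<times> real"
  let ?w = "\<lambda>t. weight 0 * c * (t * \<bar>q t\<bar>) + (\<bar>snd a\<bar> + 1) * (weight 0 * c) * \<bar>q t\<bar>"
  have "integrable Rplus ?w"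
    by (intro Bochner_Integration.integrable_add Bochner_Integration.integrable_mult_right abs_q_int t_abs_q_int)
  moreover have "\<forall>\<^sub>F z::real\<times>real in nhds a. \<bar>snd z - snd a\<bar> < 1"
  proof -
    have "((\<lambda>z. snd z) \<longlongrightarrow> snd a) (nhds a)" by (intro tendsto_intros filterlim_ident)
    from tendstoD[OF this, of 1] show ?thesis by (simp add: dist_real_def)
  qed
  then have "\<forall>\<^sub>F z in nhds a. \<forall>t\<in>space Rplus.
      \<bar>green (2 * \<bar>fst z\<bar>) (t - snd z) * (q t * (weight t * g (fst z, t)))\<bar> \<le> ?w t"
  proof (eventually_elim, intro ballI)
    fix z :: "real \<times> real" and t assume z: "\<bar>snd z - snd a\<bar> < 1" and "t \<in> space Rplus"
    then have t: "t > 0" by simp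
    have "\<bar>green (2 * \<bar>fst z\<bar>) (t - snd z) * (q t * (weight t * g (fst z, t)))\<bar>
        = green (2 * \<bar>fst z\<bar>) (t - snd z) * (\<bar>q t\<bar> * (weight t * \<bar>g (fst z, t)\<bar>))"
      using weight_pos[of t] by (simp add: abs_mult green_nonneg)
    also have "\<dots> \<le> (t + (\<bar>snd a\<bar> + 1)) * (\<bar>q t\<bar> * (weight 0 * c))"
    proof (intro mult_mono b weight_antimono)
      show "green (2 * \<bar>fst z\<bar>) (t - snd z) \<le> t + (\<bar>snd a\<bar> + 1)"
        using green_le[of "2 * \<bar>fst z\<bar>" "t - snd z"] z t by auto
    qed (use t weight_pos[of t] weight_pos[of 0] c in auto)
    finally show "\<bar>green (2 * \<bar>fst z\<bar>) (t - snd z) * (q t * (weight t * g (fst z, t)))\<bar> \<le> ?w t"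
      by (simp add: algebra_simps)
  qed
  ultimately show "\<exists>w. integrable Rplus w \<and> (\<forall>\<^sub>F z in nhds a. \<forall>t\<in>space Rplus.
      \<bar>green (2 * \<bar>fst z\<bar>) (t - snd z) * (q t * (weight t * g (fst z, t)))\<bar> \<le> w t)"
    by blast
qed

lemma perturb_diff:
  assumes g: "continuous_on UNIV g" "\<And>z. \<bar>g z\<bar> \<le> c" and h: "continuous_on UNIV h" "\<And>z. \<bar>h z\<bar> \<le> d"
  shows "perturb g z - perturb h z = perturb (\<lambda>z. g z - h z) z"
  unfolding perturb_def
proof (subst Bochner_Integration.integral_diff[symmetric])
  show "integrable Rplus (\<lambda>t. green (2 * \<bar>fst z\<bar>) (t - snd z) * (q t * (weight t * g (fst z, t))))"
    by (intro integrable_green perturb_integrable[OF g]) simp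
  show "integrable Rplus (\<lambda>t. green (2 * \<bar>fst z\<bar>) (t - snd z) * (q t * (weight t * h (fst z, t))))"
    by (intro integrable_green perturb_integrable[OF h]) simp
qed (simp add: algebra_simps)

text \<open>
  Banach's theorem is applied to all energies at once. The fixed point is a bounded continuous function
  of \<open>(k, x)\<close>, so the joint continuity that the compactness argument and the intermediate value theorem
  need later comes for free.
\<close>
lemma jost_family_exists:
  obtains m :: "real \<Rightarrow> real \<Rightarrow> real" and C where
    "continuous_on UNIV (\<lambda>z. m (fst z) (snd z))"
    "\<And>k x. x \<ge> 0 \<Longrightarrow> \<bar>m k x\<bar> \<le> C"
    "\<And>k x. m k x = 1 + (\<integral>t. green (2 * \<bar>k\<bar>) (t - x) * (q t * m k t) \<partial>Rplus)"
proof -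
  \<comment> \<open>The Volterra equation for \<open>m = weight g\<close>, solved for \<open>g\<close>.\<close>
  define T where "T = (\<lambda>g z. (1 + perturb g z) / weight (snd z))"
  have bound: "\<bar>apply_bcontfun g z\<bar> \<le> norm g" for g :: "(real \<times> real) \<Rightarrow>\<^sub>C real" and z
    using norm_bounded[of g z] by simp
  have T_bcont: "T (apply_bcontfun g) \<in> bcontfun" for g
  proof (rule bcontfun_normI[where b = "1 + norm g / 2"])
    show "continuous_on UNIV (T (apply_bcontfun g))"
      unfolding T_def using weight_pos
      by (intro continuous_intros continuous_perturb[where c = "norm g"] bound continuous_on_compose2[OF continuous_weight[of UNIV]])
        (auto simp: less_imp_neq[THEN not_sym])
    fix z
    have "\<bar>1 + perturb (apply_bcontfun g) z\<bar> \<le> 1 + norm g * ((weight (snd z) - 1) / 2)"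
      using perturb_bound[of "apply_bcontfun g" "norm g" z] bound by simp
    also have "\<dots> \<le> weight (snd z) + norm g * (weight (snd z) / 2)"
      using weight_ge_1[of "snd z"] by (intro add_mono mult_left_mono) auto
    finally show "norm (T (apply_bcontfun g) z) \<le> 1 + norm g / 2"
      using weight_pos[of "snd z"] by (simp add: T_def abs_divide divide_le_eq algebra_simps)
  qed
  define T' where "T' = (\<lambda>g. Bcontfun (T (apply_bcontfun g)))"
  have T': "apply_bcontfun (T' g) = T (apply_bcontfun g)" for g
    unfolding T'_def by (rule Bcontfun_inverse[OF T_bcont])
  have "\<exists>!g. T' g = g"
  proof (rule banach_fix_type[where c = "1 / 2"])
    show "\<forall>g h. dist (T' g) (T' h) \<le> 1 / 2 * dist g h"
    proof (intro allI dist_bound)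
      fix g h z
      have "\<bar>perturb (apply_bcontfun g) z - perturb (apply_bcontfun h) z\<bar>
          \<le> dist g h * ((weight (snd z) - 1) / 2)"
      proof (subst perturb_diff[OF _ bound _ bound])
        show "\<bar>perturb (\<lambda>z. apply_bcontfun g z - apply_bcontfun h z) z\<bar> \<le> dist g h * ((weight (snd z) - 1) / 2)"
          by (rule perturb_bound) (use dist_bounded[of g _ h] in \<open>auto intro!: continuous_intros simp: dist_real_def\<close>)
      qed auto
      also have "\<dots> \<le> dist g h * (weight (snd z) / 2)" by (intro mult_left_mono) auto
      finally show "dist (apply_bcontfun (T' g) z) (apply_bcontfun (T' h) z) \<le> 1 / 2 * dist g h"
        using weight_pos[of "snd z"]
        by (simp add: T' T_def dist_real_def diff_divide_distrib[symmetric] abs_divide divide_le_eq mult_ac)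
    qed
  qed auto
  then obtain g where "T' g = g" by blast
  then have fix_eq: "T (apply_bcontfun g) = apply_bcontfun g" using T' by metis
  define m where "m = (\<lambda>k x. weight x * apply_bcontfun g (k, x))"
  show thesis
  proof (rule that[of m "weight 0 * norm g"])
    show "continuous_on UNIV (\<lambda>z. m (fst z) (snd z))"
      unfolding m_def by (intro continuous_intros continuous_on_compose2[OF continuous_weight[of UNIV]]) auto
    show "\<bar>m k x\<bar> \<le> weight 0 * norm g" if "x \<ge> 0" for k x
      unfolding m_def abs_mult using weight_pos[of x] weight_pos[of 0] weight_antimono[OF that] bound
      by (intro mult_mono) auto
    fix k x
    have "m k x = weight x * T (apply_bcontfun g) (k, x)" by (simp add: m_def fix_eq)
    also have "\<dots> = 1 + perturb (apply_bcontfun g) (k, x)" using weight_pos[of x] by (simp add: T_def)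
    finally show "m k x = 1 + (\<integral>t. green (2 * \<bar>k\<bar>) (t - x) * (q t * m k t) \<partial>Rplus)"
      by (simp add: perturb_def m_def)
  qed
qed

end

section \<open>Properties of the Jost solutions\<close>

text \<open>
  The function \<open>e\<^bsup>-|k|x\<^esup> m(k, x)\<close> is the Jost solution of \<open>f'' = (k\<^sup>2 + q) f\<close>. The equation for \<open>m\<close> is
  the integrated form of \<open>m'' = 2|k| m' + q m\<close> with \<open>m \<rightarrow> 1\<close> at infinity.
\<close>
locale jost_family = half_line_potential +
  fixes m :: "real \<Rightarrow> real \<Rightarrow> real" and C :: real
  assumes m_cont2: "continuous_on UNIV (\<lambda>z. m (fst z) (snd z))"
    and m_bound: "\<And>k x. x \<ge> 0 \<Longrightarrow> \<bar>m k x\<bar> \<le> C"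
    and m_eq: "\<And>k x. m k x = 1 + (\<integral>t. green (2 * \<bar>k\<bar>) (t - x) * (q t * m k t) \<partial>Rplus)"
begin

lemma continuous_m [continuous_intros]:
  "continuous_on S f \<Longrightarrow> continuous_on S g \<Longrightarrow> continuous_on S (\<lambda>x. m (f x) (g x))"
  using continuous_on_compose2[OF m_cont2, of S "\<lambda>x. (f x, g x)"] by (simp add: continuous_on_Pair)

lemma measurable_m [measurable]: "m k \<in> borel_measurable Rplus"
  by (rule continuous_imp_measurable_Rplus) (intro continuous_intros)

lemma C_nonneg: "C \<ge> 0"
  using m_bound[of 0 0] by simp

lemma qm_int: "integrable Rplus (\<lambda>t. q t * m k t)"
  using integrable_Rplus_mult_bounded[OF q_int measurable_m[of k], of C] m_bound
  by (simp add: mult.commute)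

lemma tqm_int: "integrable Rplus (\<lambda>t. t * (q t * m k t))"
  using integrable_Rplus_mult_bounded[OF tq_int measurable_m[of k], of C] m_bound
  by (simp add: mult_ac)

definition q_norm :: real where "q_norm = (\<integral>t. \<bar>q t\<bar> \<partial>Rplus)"

lemma q_norm_nonneg: "q_norm \<ge> 0"
  unfolding q_norm_def by (intro Bochner_Integration.integral_nonneg) simp

lemma weighted_integral_bound:
  assumes f: "f \<in> borel_measurable Rplus" and b: "\<And>t. t > 0 \<Longrightarrow> \<bar>f t\<bar> \<le> c"
  shows "\<bar>\<integral>t. f t * q t \<partial>Rplus\<bar> \<le> c * q_norm"
proof -
  have "\<bar>\<integral>t. f t * q t \<partial>Rplus\<bar> \<le> (\<integral>t. \<bar>f t * q t\<bar> \<partial>Rplus)" by (rule integral_abs_bound)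
  also have "\<dots> \<le> (\<integral>t. c * \<bar>q t\<bar> \<partial>Rplus)"
    by (intro integral_mono integrable_abs integrable_Rplus_mult_bounded[OF q_int f b]
        Bochner_Integration.integrable_mult_right abs_q_int)
      (auto simp: abs_mult intro!: mult_right_mono b)
  finally show ?thesis by (simp add: q_norm_def)
qed

text \<open>
  The derivative of \<open>m\<close> in \<open>x\<close>, in the form that differentiation under the integral sign produces.
\<close>
definition dm :: "real \<Rightarrow> real \<Rightarrow> real" where
  "dm k x = - (\<integral>t. indicator {x<..} t * (exp (- (2 * \<bar>k\<bar>) * (t - x)) * (q t * m k t)) \<partial>Rplus)"

lemma measurable_exp_Rplus [measurable]: "(\<lambda>t. exp (a * (t - x))) \<in> borel_measurable Rplus"
  by (rule continuous_imp_measurable_Rplus) (intro continuous_intros)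

lemma m_has_derivative: "(m k has_real_derivative dm k x) (at x)"
proof -
  have "((\<lambda>x. 1 + (\<integral>t. green (2 * \<bar>k\<bar>) (t - x) * (q t * m k t) \<partial>Rplus)) has_real_derivative dm k x) (at x)"
    unfolding dm_def
    by (auto intro!: derivative_eq_intros green_integral_has_derivative qm_int tqm_int)
  moreover have "m k = (\<lambda>x. 1 + (\<integral>t. green (2 * \<bar>k\<bar>) (t - x) * (q t * m k t) \<partial>Rplus))"
    by (rule ext) (rule m_eq)
  ultimately show ?thesis by (simp only:)
qed

lemma dm_bound: "\<bar>dm k x\<bar> \<le> C * q_norm"
proof -
  let ?f = "\<lambda>t. indicator {x<..} t * (exp (- (2 * \<bar>k\<bar>) * (t - x)) * m k t)"
  have "\<bar>\<integral>t. ?f t * q t \<partial>Rplus\<bar> \<le> C * q_norm"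
  proof (rule weighted_integral_bound)
    show "?f \<in> borel_measurable Rplus" by measurable
    fix t :: real assume "t > 0"
    then have "exp (- (2 * \<bar>k\<bar>) * (t - x)) * \<bar>m k t\<bar> \<le> 1 * C" if "t > x"
      using that by (intro mult_mono m_bound) (auto intro!: mult_nonneg_nonneg)
    then show "\<bar>?f t\<bar> \<le> C" using C_nonneg by (auto simp: indicator_def abs_mult)
  qed
  then show ?thesis by (simp add: dm_def mult_ac)
qed

text \<open>
  Multiplying \<open>dm\<close> by the integrating factor \<open>e\<^bsup>-2|k|x\<^esup>\<close> leaves a plain tail integral: its integrand
  does not involve \<open>x\<close>, so increments and almost everywhere derivatives can be read off.
\<close>
definition scaled_dm :: "real \<Rightarrow> real \<Rightarrow> real" where
  "scaled_dm k x = - (\<integral>t. indicator {x<..} t * (exp (- (2 * \<bar>k\<bar>) * t) * (q t * m k t)) \<partial>Rplus)"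

lemma dm_eq_scaled_dm: "dm k x = exp (2 * \<bar>k\<bar> * x) * scaled_dm k x"
proof -
  have "exp (- (2 * \<bar>k\<bar>) * (t - x)) = exp (2 * \<bar>k\<bar> * x) * exp (- (2 * \<bar>k\<bar>) * t)" for t
    by (simp add: exp_add[symmetric] algebra_simps)
  then have "dm k x = - (\<integral>t. exp (2 * \<bar>k\<bar> * x) * (indicator {x<..} t * (exp (- (2 * \<bar>k\<bar>) * t) * (q t * m k t))) \<partial>Rplus)"
    unfolding dm_def by (simp only: mult_ac)
  then show ?thesis by (simp add: scaled_dm_def)
qed

lemma scaled_dm_integrand_int: "integrable Rplus (\<lambda>t. exp (- (2 * \<bar>k\<bar>) * t) * (q t * m k t))"
  using measurable_exp_Rplus[of "- (2 * \<bar>k\<bar>)" 0]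
  by (intro integrable_Rplus_mult_bounded[OF qm_int, where C = 1]) auto

lemma scaled_dm_diff:
  assumes "x \<le> y"
  shows "scaled_dm k y - scaled_dm k x = (\<integral>t. indicator {x<..y} t * (exp (- (2 * \<bar>k\<bar>) * t) * (q t * m k t)) \<partial>Rplus)"
proof -
  have "scaled_dm k y - scaled_dm k x = (\<integral>t. indicator {x<..} t * (exp (- (2 * \<bar>k\<bar>) * t) * (q t * m k t))
      - indicator {y<..} t * (exp (- (2 * \<bar>k\<bar>) * t) * (q t * m k t)) \<partial>Rplus)"
    unfolding scaled_dm_def
    by (subst Bochner_Integration.integral_diff[OF integrable_Rplus_tail[OF scaled_dm_integrand_int] integrable_Rplus_tail[OF scaled_dm_integrand_int]]) simp
  also have "\<dots> = (\<integral>t. indicator {x<..y} t * (exp (- (2 * \<bar>k\<bar>) * t) * (q t * m k t)) \<partial>Rplus)"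
    using assms by (intro Bochner_Integration.integral_cong) (auto simp: indicator_def)
  finally show ?thesis .
qed

lemma dm_has_derivative_AE:
  "AE x in Rplus. (dm k has_real_derivative 2 * \<bar>k\<bar> * dm k x + q x * m k x) (at x)"
  using tail_integral_has_derivative_AE[OF scaled_dm_integrand_int[of k]]
proof eventually_elim
  case (elim x)
  then have scaled_dm': "(scaled_dm k has_real_derivative exp (- (2 * \<bar>k\<bar>) * x) * (q x * m k x)) (at x)"
    unfolding scaled_dm_def[abs_def] by (auto intro!: derivative_eq_intros)
  have "((\<lambda>x. exp (2 * \<bar>k\<bar> * x) * scaled_dm k x) has_real_derivative 2 * \<bar>k\<bar> * dm k x + q x * m k x) (at x)"
  proof (rule DERIV_cong)
    show "((\<lambda>x. exp (2 * \<bar>k\<bar> * x) * scaled_dm k x) has_real_derivative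
        (2 * \<bar>k\<bar> * exp (2 * \<bar>k\<bar> * x)) * scaled_dm k x
        + (exp (- (2 * \<bar>k\<bar>) * x) * (q x * m k x)) * exp (2 * \<bar>k\<bar> * x)) (at x)"
      by (intro DERIV_mult scaled_dm') (auto intro!: derivative_eq_intros)
    have "(exp (- (2 * \<bar>k\<bar>) * x) * (q x * m k x)) * exp (2 * \<bar>k\<bar> * x)
        = (exp (- (2 * \<bar>k\<bar>) * x) * exp (2 * \<bar>k\<bar> * x)) * (q x * m k x)"
      by (simp only: mult_ac)
    also have "\<dots> = q x * m k x"
      by (simp add: exp_add[symmetric])
    finally have eq: "(exp (- (2 * \<bar>k\<bar>) * x) * (q x * m k x)) * exp (2 * \<bar>k\<bar> * x) = q x * m k x" .
    show "(2 * \<bar>k\<bar> * exp (2 * \<bar>k\<bar> * x)) * scaled_dm k x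
        + (exp (- (2 * \<bar>k\<bar>) * x) * (q x * m k x)) * exp (2 * \<bar>k\<bar> * x) = 2 * \<bar>k\<bar> * dm k x + q x * m k x"
      unfolding eq dm_eq_scaled_dm by (simp only: mult.assoc)
  qed
  moreover have "dm k = (\<lambda>x. exp (2 * \<bar>k\<bar> * x) * scaled_dm k x)"
    by (rule ext) (rule dm_eq_scaled_dm)
  ultimately show ?case by (simp only:)
qed

lemma m_tail_bound:
  assumes "x \<ge> 0"
  shows "\<bar>m k x - 1\<bar> \<le> C * (\<integral>t. indicator {x<..} t * (t * \<bar>q t\<bar>) \<partial>Rplus)"
proof -
  have "\<bar>m k x - 1\<bar> \<le> (\<integral>t. indicator {x<..} t * (t * \<bar>q t * m k t\<bar>) \<partial>Rplus)"
    using green_integral_le_tail[OF _ qm_int[of k] tqm_int[of k] assms, of "2 * \<bar>k\<bar>"] m_eq[of k x] by simp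
  also have "\<dots> \<le> (\<integral>t. C * (indicator {x<..} t * (t * \<bar>q t\<bar>)) \<partial>Rplus)"
  proof (rule integral_mono)
    have "integrable Rplus (\<lambda>t. \<bar>t * (q t * m k t)\<bar>)" by (intro integrable_abs tqm_int)
    then have "integrable Rplus (\<lambda>t. t * \<bar>q t * m k t\<bar>)"
      by (rule Bochner_Integration.integrable_cong[THEN iffD1, rotated -1]) (auto simp: abs_mult)
    then show "integrable Rplus (\<lambda>t. indicator {x<..} t * (t * \<bar>q t * m k t\<bar>))"
      by (rule integrable_Rplus_tail)
    show "integrable Rplus (\<lambda>t. C * (indicator {x<..} t * (t * \<bar>q t\<bar>)))"
      by (intro Bochner_Integration.integrable_mult_right integrable_Rplus_tail t_abs_q_int)
    fix t assume "t \<in> space Rplus"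
    then have "t > 0" by simp
    then have "t * (\<bar>q t\<bar> * \<bar>m k t\<bar>) \<le> t * (\<bar>q t\<bar> * C)"
      by (intro mult_left_mono m_bound) auto
    then show "indicator {x<..} t * (t * \<bar>q t * m k t\<bar>) \<le> C * (indicator {x<..} t * (t * \<bar>q t\<bar>))"
      by (auto simp: indicator_def abs_mult mult_ac)
  qed
  finally show ?thesis by simp
qed

text \<open>
  One threshold serves all \<open>k\<close>; this confines the zeros of the whole family to a compact interval.
\<close>
lemma m_eventually_large:
  obtains X where "X \<ge> 0" "\<And>k x. x \<ge> X \<Longrightarrow> m k x > 1 / 2"
proof -
  have "((\<lambda>x. C * (\<integral>t. indicator {x<..} t * (t * \<bar>q t\<bar>) \<partial>Rplus)) \<longlongrightarrow> C * 0) at_top"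
    by (intro tendsto_intros tail_integral_tendsto_0 t_abs_q_int)
  then have "\<forall>\<^sub>F x in at_top. C * (\<integral>t. indicator {x<..} t * (t * \<bar>q t\<bar>) \<partial>Rplus) < 1 / 2"
    by (rule order_tendstoD) simp
  then obtain X where X: "\<And>x. x \<ge> X \<Longrightarrow> C * (\<integral>t. indicator {x<..} t * (t * \<bar>q t\<bar>) \<partial>Rplus) < 1 / 2"
    by (auto simp: eventually_at_top_linorder)
  show thesis
  proof (rule that[of "max X 0"])
    fix k x assume "max X 0 \<le> x"
    then show "m k x > 1 / 2" using X[of x] m_tail_bound[of x k] by (simp add: abs_le_iff)
  qed simp
qed

lemma m_bound_large_k:
  assumes "k > 0"
  shows "\<bar>m k x - 1\<bar> \<le> C * q_norm / (2 * k)"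
proof -
  let ?f = "\<lambda>t. green (2 * k) (t - x) * m k t"
  have "\<bar>\<integral>t. ?f t * q t \<partial>Rplus\<bar> \<le> (1 / (2 * k) * C) * q_norm"
  proof (rule weighted_integral_bound)
    show "?f \<in> borel_measurable Rplus" by measurable
    show "\<bar>?f t\<bar> \<le> 1 / (2 * k) * C" if "t > 0" for t
      unfolding abs_mult using assms that green_nonneg[of "2 * k"] green_le_inverse[of "2 * k"]
      by (intro mult_mono m_bound) auto
  qed
  then show ?thesis using m_eq[of k x] assms by (simp add: mult_ac)
qed

lemma continuous_dm_0: "continuous_on UNIV (\<lambda>k. dm k 0)"
proof -
  have "continuous_on UNIV (\<lambda>k. \<integral>t. indicator {0<..} t * (exp (- (2 * \<bar>k\<bar>) * (t - 0)) * (q t * m k t)) \<partial>Rplus)"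
  proof (rule continuous_on_integral_dominated)
    have [measurable]: "q \<in> borel_measurable Rplus" using q_int by simp
    show "(\<lambda>t. indicator {0<..} t * (exp (- (2 * \<bar>k\<bar>) * (t - 0)) * (q t * m k t))) \<in> borel_measurable Rplus" for k
      by measurable
    show "continuous_on UNIV (\<lambda>k. indicator {0<..} t * (exp (- (2 * \<bar>k\<bar>) * (t - 0)) * (q t * m k t)))" for t
      by (intro continuous_intros)
    have "integrable Rplus (\<lambda>t. C * \<bar>q t\<bar>)"
      by (intro Bochner_Integration.integrable_mult_right abs_q_int)
    moreover have "\<bar>indicator {0<..} t * (exp (- (2 * \<bar>k\<bar>) * (t - 0)) * (q t * m k t))\<bar> \<le> C * \<bar>q t\<bar>" if "t > 0" for t k
    proof -
      have "exp (- (2 * \<bar>k\<bar>) * (t - 0)) * (\<bar>q t\<bar> * \<bar>m k t\<bar>) \<le> 1 * (\<bar>q t\<bar> * C)"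
        using that by (intro mult_mono m_bound) auto
      then show ?thesis using that by (simp add: abs_mult mult_ac)
    qed
    ultimately show "\<exists>w. integrable Rplus w \<and> (\<forall>\<^sub>F k in nhds a. \<forall>t\<in>space Rplus.
      \<bar>indicator {0<..} t * (exp (- (2 * \<bar>k\<bar>) * (t - 0)) * (q t * m k t))\<bar> \<le> w t)" for a
      by (intro exI[of _ "\<lambda>t. C * \<bar>q t\<bar>"]) (auto intro!: always_eventually)
  qed
  then show ?thesis unfolding dm_def by (rule continuous_on_minus)
qed

text \<open>
  Let \<open>A\<close> be the maximum of \<open>|m|\<close> on \<open>[y, y + \<delta>]\<close>. With vanishing initial data, \<open>|dm|\<close> is at most
  \<open>e\<^bsup>2|k|\<delta>\<^esup> A q_norm\<close> there, hence \<open>A \<le> \<delta> e\<^bsup>2|k|\<delta>\<^esup> A q_norm \<le> A/2\<close>, and \<open>A = 0\<close>. The admissible step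
  length does not depend on \<open>y\<close>.
\<close>
lemma zero_data_propagates:
  assumes y: "y \<ge> 0" "m k y = 0" "dm k y = 0"
    and \<delta>: "\<delta> > 0" "\<delta> * exp (2 * \<bar>k\<bar> * \<delta>) * q_norm \<le> 1 / 2"
  shows "m k (y + \<delta>) = 0 \<and> dm k (y + \<delta>) = 0"
proof -
  have "\<exists>s\<in>{y..y+\<delta>}. \<forall>t\<in>{y..y+\<delta>}. \<bar>m k t\<bar> \<le> \<bar>m k s\<bar>"
    using \<delta>(1) by (intro continuous_attains_sup) (auto intro!: continuous_intros)
  then obtain s where s: "s \<in> {y..y+\<delta>}" "\<And>t. t \<in> {y..y+\<delta>} \<Longrightarrow> \<bar>m k t\<bar> \<le> \<bar>m k s\<bar>" by blast
  define A where "A = \<bar>m k s\<bar>"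
  have dm_le: "\<bar>dm k x\<bar> \<le> exp (2 * \<bar>k\<bar> * \<delta>) * A * q_norm" if x: "x \<in> {y..y+\<delta>}" for x
  proof -
    have "scaled_dm k y = 0" using y(3) dm_eq_scaled_dm[of k y] by simp
    then have "dm k x = exp (2 * \<bar>k\<bar> * x) *
        (\<integral>t. indicator {y<..x} t * (exp (- (2 * \<bar>k\<bar>) * t) * (q t * m k t)) \<partial>Rplus)"
      using scaled_dm_diff[of y x k] x dm_eq_scaled_dm[of k x] by simp
    also have "\<dots> = (\<integral>t. exp (2 * \<bar>k\<bar> * x) * (indicator {y<..x} t * (exp (- (2 * \<bar>k\<bar>) * t) * (q t * m k t))) \<partial>Rplus)"
      by simp
    also have "\<dots> = (\<integral>t. (indicator {y<..} t - indicator {x<..} t) * (exp (- (2 * \<bar>k\<bar>) * (t - x)) * m k t) * q t \<partial>Rplus)"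
      using x by (intro Bochner_Integration.integral_cong)
        (auto simp: indicator_def exp_minus exp_diff algebra_simps field_simps)
    also have "\<bar>\<dots>\<bar> \<le> (exp (2 * \<bar>k\<bar> * \<delta>) * A) * q_norm"
    proof (rule weighted_integral_bound)
      fix t :: real
      have "exp (- (2 * \<bar>k\<bar>) * (t - x)) * \<bar>m k t\<bar> \<le> exp (2 * \<bar>k\<bar> * \<delta>) * A" if "t > y" "t \<le> x"
      proof (rule mult_mono)
        have "2 * \<bar>k\<bar> * (x - t) \<le> 2 * \<bar>k\<bar> * \<delta>" using that x by (intro mult_left_mono) auto
        then show "exp (- (2 * \<bar>k\<bar>) * (t - x)) \<le> exp (2 * \<bar>k\<bar> * \<delta>)" by (simp add: algebra_simps)
        show "\<bar>m k t\<bar> \<le> A" unfolding A_def using that x by (intro s) auto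
      qed auto
      then show "\<bar>(indicator {y<..} t - indicator {x<..} t) * (exp (- (2 * \<bar>k\<bar>) * (t - x)) * m k t)\<bar>
          \<le> exp (2 * \<bar>k\<bar> * \<delta>) * A"
        using x by (auto simp: indicator_def abs_mult A_def)
    qed measurable
    finally show ?thesis .
  qed
  have "\<bar>m k s - m k y\<bar> \<le> exp (2 * \<bar>k\<bar> * \<delta>) * A * q_norm * \<bar>s - y\<bar>"
    using field_differentiable_bound[of "{y..y+\<delta>}" "m k" "dm k" "exp (2 * \<bar>k\<bar> * \<delta>) * A * q_norm" s y]
      dm_le m_has_derivative s(1) \<delta>(1) by (auto intro: has_field_derivative_at_within)
  also have "\<dots> \<le> exp (2 * \<bar>k\<bar> * \<delta>) * A * q_norm * \<delta>"
    using s(1) q_norm_nonneg by (intro mult_left_mono) (auto simp: A_def)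
  also have "\<dots> = (\<delta> * exp (2 * \<bar>k\<bar> * \<delta>) * q_norm) * A" by simp
  also have "\<dots> \<le> 1 / 2 * A" using \<delta>(2) by (rule mult_right_mono) (simp add: A_def)
  finally have "A = 0" using y(2) by (simp add: A_def)
  then show ?thesis using s(2)[of "y + \<delta>"] dm_le[of "y + \<delta>"] \<delta>(1) by (simp add: A_def)
qed

text \<open>
  Repeating the step of fixed length carries the vanishing data to infinity, where \<open>m\<close> is close to 1.
\<close>
lemma no_zero_data:
  assumes y: "y \<ge> 0" "m k y = 0" "dm k y = 0"
  shows False
proof -
  \<comment> \<open>Since \<open>\<delta> \<le> 1\<close>, the exponential factor is at most \<open>e\<^bsup>2|k|\<^esup>\<close>; adding 1 to \<open>q_norm\<close> avoids a zero denominator.\<close>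
  define \<delta> where "\<delta> = min 1 (1 / (2 * exp (2 * \<bar>k\<bar>) * (q_norm + 1)))"
  have \<delta>0: "\<delta> > 0" "\<delta> \<le> 1" using q_norm_nonneg by (auto simp: \<delta>_def)
  have "\<delta> * exp (2 * \<bar>k\<bar> * \<delta>) * q_norm \<le> (1 / (2 * exp (2 * \<bar>k\<bar>) * (q_norm + 1))) * exp (2 * \<bar>k\<bar> * 1) * (q_norm + 1)"
    using \<delta>0 q_norm_nonneg by (intro mult_mono) (auto simp: \<delta>_def intro!: mult_left_le)
  also have "\<dots> = 1 / 2" using q_norm_nonneg add_nonneg_pos[of q_norm 1] by (simp add: divide_simps)
  finally have \<delta>: "\<delta> * exp (2 * \<bar>k\<bar> * \<delta>) * q_norm \<le> 1 / 2" .
  have zero: "m k (y + real j * \<delta>) = 0 \<and> dm k (y + real j * \<delta>) = 0" for j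
  proof (induction j)
    case (Suc j)
    then show ?case
      using zero_data_propagates[of "y + real j * \<delta>" k \<delta>] y(1) \<delta>0(1) \<delta>
      by (simp add: algebra_simps)
  qed (use y in auto)
  obtain X where X: "\<And>k x. x \<ge> X \<Longrightarrow> m k x > 1 / 2" using m_eventually_large by blast
  obtain j :: nat where "X / \<delta> < real j" using reals_Archimedean2 by blast
  then have "X \<le> y + real j * \<delta>" using \<delta>0 y(1) by (simp add: divide_less_eq)
  then show False using X[of "y + real j * \<delta>" k] zero[of j] by simp
qed

section \<open>A zero of the shooting function\<close>

text \<open>
  The Riccati identity \<open>w(0) = - \<integral>q + \<integral>w\<^sup>2\<close> for \<open>w = m'/m\<close> at zero energy. As \<open>w\<close> is differentiable
  only almost everywhere, it is replaced by
  \<open>G(x) = \<integral>\<^bsub>t>x\<^esub> q(t) m(t) (1/m(t) - 1/m(x)) dt = \<integral>\<^bsub>t>x\<^esub> q + w(x)\<close>. Its integrand is Lipschitz in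
  \<open>x\<close>, because it vanishes at \<open>t = x\<close>, so \<open>G\<close> is differentiable everywhere with \<open>G' = - w\<^sup>2\<close>. As \<open>G\<close>
  tends to 0, it is nonnegative; and if \<open>G(0) = 0\<close>, then \<open>G\<close> and hence \<open>w\<close> vanish identically, which
  makes \<open>m\<close> constant and \<open>q\<close> zero.
\<close>
lemma dm_0_pos_if_m_pos:
  assumes pos: "\<And>x. x \<ge> 0 \<Longrightarrow> m 0 x > 0"
    and mean: "(\<integral>t. q t \<partial>Rplus) \<le> 0" and nz: "\<not> (AE t in Rplus. q t = 0)"
  shows "dm 0 0 > 0"
proof -
  let ?h = "\<lambda>t. q t * m 0 t"
  have dm0: "dm 0 x = - (\<integral>t. indicator {x<..} t * ?h t \<partial>Rplus)" for x by (simp add: dm_def)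
  obtain X where X: "X \<ge> 0" "\<And>k x. x \<ge> X \<Longrightarrow> m k x > 1 / 2" using m_eventually_large by blast
  have "\<exists>s\<in>{0..X}. \<forall>t\<in>{0..X}. m 0 s \<le> m 0 t"
    using X(1) by (intro continuous_attains_inf) (auto intro!: continuous_intros)
  then obtain s where s: "s \<in> {0..X}" "\<And>t. t \<in> {0..X} \<Longrightarrow> m 0 s \<le> m 0 t" by blast
  \<comment> \<open>The minimum over \<open>[0, X]\<close> is a positive lower bound there; beyond \<open>X\<close> the bound \<open>1/2\<close> takes over.\<close>
  define c where "c = min (m 0 s) (1 / 2)"
  have c: "c > 0" using pos[of s] s(1) by (auto simp: c_def)
  have c_le: "c \<le> m 0 x" if "x \<ge> 0" for x
    using s(2)[of x] X(2)[of x 0] that by (cases "x \<le> X") (auto simp: c_def)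
  define r where "r = (\<lambda>x. 1 / m 0 x)"
  define r' where "r' = (\<lambda>x. - dm 0 x / (m 0 x)\<^sup>2)"
  \<comment> \<open>A Lipschitz constant for \<open>r = 1/m\<close> on the closed half-line.\<close>
  define l where "l = C * q_norm / c\<^sup>2"
  have r_der: "(r has_real_derivative r' x) (at x)" if "x \<ge> 0" for x
    unfolding r_def r'_def using pos[OF that]
    by (auto intro!: derivative_eq_intros m_has_derivative simp: power2_eq_square)
  have r'_le: "\<bar>r' x\<bar> \<le> l" if "x \<ge> 0" for x
  proof -
    have "c\<^sup>2 \<le> (m 0 x)\<^sup>2" using c c_le[OF that] by (intro power_mono) auto
    then have "\<bar>dm 0 x\<bar> / (m 0 x)\<^sup>2 \<le> C * q_norm / c\<^sup>2"
      using dm_bound[of 0 x] c C_nonneg q_norm_nonneg by (intro frac_le) auto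
    then show ?thesis by (simp add: r'_def l_def)
  qed
  have r_lip: "\<bar>r x - r y\<bar> \<le> l * \<bar>x - y\<bar>" if "x \<ge> 0" "y \<ge> 0" for x y
    using field_differentiable_bound[of "{0..}" r r' l x y] r_der r'_le that
    by (auto intro: has_field_derivative_at_within)
  have r_bound: "\<bar>r x\<bar> \<le> 1 / c" if "x \<ge> 0" for x
    using c c_le[OF that] by (auto simp: r_def intro!: frac_le)
  have l: "l \<ge> 0" using C_nonneg q_norm_nonneg by (simp add: l_def)
  have [measurable]: "r \<in> borel_measurable Rplus" unfolding r_def by measurable
  have [measurable]: "q \<in> borel_measurable Rplus" using q_int by simp
  define \<kappa> where "\<kappa> = (\<lambda>x t. (indicator {x<..} t * (r t - r x)) * ?h t)"
  define G where "G = (\<lambda>x. \<integral>t. \<kappa> x t \<partial>Rplus)"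
  have \<kappa>_bound: "\<bar>indicator {x<..} t * (r t - r x)\<bar> \<le> 2 / c" if "t > 0" "x \<ge> 0" for t x :: real
    using r_bound[of t] r_bound[of x] that c by (auto simp: indicator_def)
  have \<kappa>_int: "integrable Rplus (\<kappa> x)" if "x \<ge> 0" for x
    unfolding \<kappa>_def by (rule integrable_Rplus_mult_bounded[OF qm_int _ \<kappa>_bound]) (use that in auto)
  have G_der: "(G has_real_derivative - (dm 0 x / m 0 x)\<^sup>2) (at x within {0..})" if x: "x \<ge> 0" for x
  proof -
    have "(G has_real_derivative (\<integral>t. - r' x * (indicator {x<..} t * ?h t) \<partial>Rplus)) (at x within {0..})"
      unfolding G_def
    proof (rule has_field_derivative_integral_Lipschitz[where h = "\<lambda>t. l * \<bar>?h t\<bar>"])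
      show "x \<in> {0..}" using x by simp
      show "integrable Rplus (\<kappa> y)" if "y \<in> {0..}" for y using \<kappa>_int that by simp
      show "integrable Rplus (\<lambda>t. l * \<bar>?h t\<bar>)"
        by (intro Bochner_Integration.integrable_mult_right integrable_abs qm_int)
      show "\<bar>\<kappa> y t - \<kappa> x t\<bar> \<le> l * \<bar>?h t\<bar> * \<bar>y - x\<bar>" if y: "y \<in> {0..}" and t: "t \<in> space Rplus" for y t
      proof -
        have "\<bar>indicator {y<..} t * (r t - r y) - indicator {x<..} t * (r t - r x)\<bar> \<le> l * \<bar>y - x\<bar>"
        proof -
          \<comment> \<open>If \<open>t\<close> lies between \<open>x\<close> and \<open>y\<close>, only one of the two terms survives, and it is small since \<open>r t - r y\<close> vanishes at \<open>t = y\<close>.\<close>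
          have "l * \<bar>t - y\<bar> \<le> l * \<bar>y - x\<bar>" if "y < t" "t \<le> x" using that l by (intro mult_left_mono) auto
          moreover have "l * \<bar>t - x\<bar> \<le> l * \<bar>y - x\<bar>" if "x < t" "t \<le> y" using that l by (intro mult_left_mono) auto
          ultimately show ?thesis
            using r_lip[of t y] r_lip[of t x] r_lip[of x y] y t x l
            by (auto simp: indicator_def abs_minus_commute)
        qed
        then have "\<bar>indicator {y<..} t * (r t - r y) - indicator {x<..} t * (r t - r x)\<bar> * \<bar>?h t\<bar> \<le> l * \<bar>y - x\<bar> * \<bar>?h t\<bar>"
          by (rule mult_right_mono) simp
        moreover have "\<kappa> y t - \<kappa> x t = (indicator {y<..} t * (r t - r y) - indicator {x<..} t * (r t - r x)) * ?h t"
          unfolding \<kappa>_def by (rule left_diff_distrib[symmetric])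
        ultimately show ?thesis by (simp only: abs_mult mult_ac)
      qed
      show "AE t in Rplus. ((\<lambda>y. \<kappa> y t) has_real_derivative - r' x * (indicator {x<..} t * ?h t)) (at x within {0..})"
        using AE_Rplus_neq[of x]
      proof eventually_elim
        case (elim t)
        show ?case
        proof (cases "t > x")
          case True
          have "((\<lambda>y. (r t - r y) * ?h t) has_real_derivative - r' x * (indicator {x<..} t * ?h t)) (at x)"
            using True r_der[OF x] by (auto intro!: derivative_eq_intros)
          moreover have "\<forall>\<^sub>F y in nhds x. (r t - r y) * ?h t = \<kappa> y t"
            by (rule eventually_mono[OF eventually_nhds_in_open[of "{..<t}" x]]) (use True in \<open>auto simp: \<kappa>_def\<close>)
          ultimately have "((\<lambda>y. \<kappa> y t) has_real_derivative - r' x * (indicator {x<..} t * ?h t)) (at x)"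
            by (rule has_real_derivative_eventually_eq)
          then show ?thesis by (rule has_field_derivative_at_within)
        next
          case False
          have "((\<lambda>_. 0) has_real_derivative - r' x * (indicator {x<..} t * ?h t)) (at x)"
            using False by simp
          moreover have "\<forall>\<^sub>F y in nhds x. 0 = \<kappa> y t"
            by (rule eventually_mono[OF eventually_nhds_in_open[of "{t<..}" x]]) (use False elim in \<open>auto simp: \<kappa>_def\<close>)
          ultimately have "((\<lambda>y. \<kappa> y t) has_real_derivative - r' x * (indicator {x<..} t * ?h t)) (at x)"
            by (rule has_real_derivative_eventually_eq)
          then show ?thesis by (rule has_field_derivative_at_within)
        qed
      qed
    qed measurable
    also have "(\<integral>t. - r' x * (indicator {x<..} t * ?h t) \<partial>Rplus) = - (dm 0 x / m 0 x)\<^sup>2"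
      by (simp add: dm0 r'_def power2_eq_square)
    finally show ?thesis .
  qed
  have G_der_at: "(G has_real_derivative - (dm 0 x / m 0 x)\<^sup>2) (at x)" if "x > 0" for x
    using G_der[of x] that at_within_interior[of x "{0..}"] by simp
  have G_mono: "G y \<le> G x" if "0 \<le> x" "x \<le> y" for x y
  proof (cases "x = y")
    case False
    show ?thesis
    proof (rule DERIV_nonpos_imp_decreasing_open[of x y G])
      show "\<exists>d. (G has_real_derivative d) (at z) \<and> d \<le> 0" if "x < z" "z < y" for z
        using G_der_at[of z] that \<open>0 \<le> x\<close> by (intro exI[of _ "- (dm 0 z / m 0 z)\<^sup>2"]) simp
      show "continuous_on {x..y} G"
      proof (rule DERIV_continuous_on)
        show "(G has_real_derivative - (dm 0 z / m 0 z)\<^sup>2) (at z within {x..y})" if "z \<in> {x..y}" for z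
          by (rule DERIV_subset[OF G_der]) (use that \<open>0 \<le> x\<close> in auto)
      qed
    qed (use that in auto)
  qed simp
  have "(G \<longlongrightarrow> 0) at_top"
  proof (rule Lim_null_comparison)
    have h: "integrable Rplus (\<lambda>t. 2 / c * \<bar>?h t\<bar>)"
      by (intro Bochner_Integration.integrable_mult_right integrable_abs qm_int)
    show "((\<lambda>x. \<integral>t. indicator {x<..} t * (2 / c * \<bar>?h t\<bar>) \<partial>Rplus) \<longlongrightarrow> 0) at_top"
      by (rule tail_integral_tendsto_0[OF h])
    show "\<forall>\<^sub>F x in at_top. norm (G x) \<le> (\<integral>t. indicator {x<..} t * (2 / c * \<bar>?h t\<bar>) \<partial>Rplus)"
      using eventually_ge_at_top[of 0]
    proof eventually_elim
      case (elim x)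
      have "\<bar>G x\<bar> \<le> (\<integral>t. \<bar>\<kappa> x t\<bar> \<partial>Rplus)" unfolding G_def by (rule integral_abs_bound)
      also have "\<dots> \<le> (\<integral>t. indicator {x<..} t * (2 / c * \<bar>?h t\<bar>) \<partial>Rplus)"
      proof (rule integral_mono)
        show "integrable Rplus (\<lambda>t. \<bar>\<kappa> x t\<bar>)" by (intro integrable_abs \<kappa>_int elim)
        show "integrable Rplus (\<lambda>t. indicator {x<..} t * (2 / c * \<bar>?h t\<bar>))" by (rule integrable_Rplus_tail[OF h])
        fix t assume "t \<in> space Rplus"
        then have "\<bar>indicator {x<..} t * (r t - r x)\<bar> * \<bar>?h t\<bar> \<le> 2 / c * \<bar>?h t\<bar>"
          using \<kappa>_bound[of t x] elim by (intro mult_right_mono) auto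
        then show "\<bar>\<kappa> x t\<bar> \<le> indicator {x<..} t * (2 / c * \<bar>?h t\<bar>)"
          by (auto simp: \<kappa>_def indicator_def abs_mult)
      qed
      finally show ?case by simp
    qed
  qed
  then have G_nonneg: "G x \<ge> 0" if "x \<ge> 0" for x
    by (rule tendsto_upperbound) (use G_mono that in \<open>auto simp: eventually_at_top_linorder\<close>)
  have "G 0 = (\<integral>t. q t - r 0 * ?h t \<partial>Rplus)"
    unfolding G_def \<kappa>_def using pos
    by (intro Bochner_Integration.integral_cong) (auto simp: r_def algebra_simps less_imp_neq[THEN not_sym])
  also have "\<dots> = (\<integral>t. q t \<partial>Rplus) - r 0 * (\<integral>t. ?h t \<partial>Rplus)"
    by (subst Bochner_Integration.integral_diff) (auto intro!: q_int qm_int)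
  also have "(\<integral>t. ?h t \<partial>Rplus) = - dm 0 0"
    unfolding dm0 minus_minus by (intro Bochner_Integration.integral_cong) auto
  finally have G0: "dm 0 0 = m 0 0 * (G 0 - (\<integral>t. q t \<partial>Rplus))"
    using pos[of 0] by (simp add: r_def field_simps)
  have "G 0 \<noteq> 0"
  proof
    assume "G 0 = 0"
    then have G_zero: "G x = 0" if "x \<ge> 0" for x using G_mono[of 0 x] G_nonneg that by force
    have dm_zero: "dm 0 x = 0" if "x > 0" for x
    proof -
      have "\<forall>\<^sub>F y in nhds x. G y = 0"
        using eventually_nhds_in_open[of "{0<..}" x] that G_zero by (auto elim!: eventually_mono)
      then have "((\<lambda>_. 0) has_real_derivative - (dm 0 x / m 0 x)\<^sup>2) (at x)"
        by (rule has_real_derivative_eventually_eq[OF G_der_at[OF that]])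
      then have "- (dm 0 x / m 0 x)\<^sup>2 = 0" using DERIV_unique DERIV_const by blast
      then show ?thesis using pos[of x] that by simp
    qed
    have "AE x in Rplus. q x = 0"
      using dm_has_derivative_AE[of 0] AE_Rplus_pos
    proof eventually_elim
      case (elim x)
      then have x: "x > 0" by simp
      have "\<forall>\<^sub>F y in nhds x. dm 0 y = 0"
        using eventually_nhds_in_open[of "{0<..}" x] x dm_zero by (auto elim!: eventually_mono)
      then have "((\<lambda>_. 0) has_real_derivative q x * m 0 x) (at x)"
        using has_real_derivative_eventually_eq[OF elim(1)] dm_zero[OF x] by simp
      then have "q x * m 0 x = 0" using DERIV_unique DERIV_const by blast
      then show ?case using pos[of x] x by simp
    qed
    with nz show False by simp
  qed
  then have "G 0 > 0" using G_nonneg[of 0] by simp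
  then show ?thesis unfolding G0 using mean pos[of 0] by simp
qed

text \<open>
  The second case takes the largest \<open>k\<close> at which the Jost solution fails to be positive. There it
  touches zero from above, and the only place where it can do so is the boundary point.
\<close>
lemma exists_shooting_pos:
  assumes mean: "(\<integral>t. q t \<partial>Rplus) \<le> 0" and nz: "\<not> (AE t in Rplus. q t = 0)"
  obtains k where "k \<ge> 0" "dm k 0 - k * m k 0 > 0"
proof (cases "\<forall>x\<ge>0. m 0 x > 0")
  case True
  then show thesis using dm_0_pos_if_m_pos[OF _ assms] that[of 0] by simp
next
  case False
  then obtain x1 where x1: "x1 \<ge> 0" "m 0 x1 \<le> 0" by (auto simp: not_less)
  obtain X where X: "X \<ge> 0" "\<And>k x. x \<ge> X \<Longrightarrow> m k x > 1 / 2" using m_eventually_large by blast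
  \<comment> \<open>For \<open>k > K\<close> the estimate for large \<open>k\<close> gives \<open>|m - 1| < 1\<close>, so no zeros occur there.\<close>
  define K where "K = C * q_norm + 1"
  have K: "K > 0" using C_nonneg q_norm_nonneg by (simp add: K_def add_nonneg_pos)
  define Z where "Z = {z \<in> {0..K} \<times> {0..X}. m (fst z) (snd z) \<le> 0}"
  have Z_iff: "(k, x) \<in> Z" if "k \<ge> 0" "x \<ge> 0" "m k x \<le> 0" for k x
  proof -
    have "x < X" using X(2)[of x k] that by (force simp: not_less)
    moreover have "k \<le> K"
    proof (rule ccontr)
      assume "\<not> k \<le> K"
      then have k: "k > K" "k > 0" using K by auto
      have "1 \<le> \<bar>m k x - 1\<bar>" using that by simp
      also have "\<dots> \<le> C * q_norm / (2 * k)" by (rule m_bound_large_k[OF k(2)])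
      finally show False using k by (simp add: le_divide_eq K_def)
    qed
    ultimately show ?thesis using that by (simp add: Z_def)
  qed
  have "compact Z"
  proof -
    have "closed {z. m (fst z) (snd z) \<le> 0}"
      by (intro closed_Collect_le continuous_intros)
    then have "compact (({0..K} \<times> {0..X}) \<inter> {z. m (fst z) (snd z) \<le> 0})"
      by (intro compact_Int_closed compact_Times) auto
    also have "({0..K} \<times> {0..X}) \<inter> {z. m (fst z) (snd z) \<le> 0} = Z" by (auto simp: Z_def)
    finally show ?thesis .
  qed
  moreover have "Z \<noteq> {}" using Z_iff[OF _ x1] by auto
  ultimately have "\<exists>z\<in>Z. \<forall>w\<in>Z. fst w \<le> fst z"
    by (intro continuous_attains_sup continuous_intros)
  then obtain k x where kx: "(k, x) \<in> Z" and max: "\<And>w. w \<in> Z \<Longrightarrow> fst w \<le> k"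
    by (metis fst_conv surj_pair)
  have k: "k \<ge> 0" "x \<ge> 0" "m k x \<le> 0" using kx by (auto simp: Z_def)
  \<comment> \<open>By maximality of \<open>k\<close>, the value is a limit of positive values from the right.\<close>
  have m_nonneg: "m k y \<ge> 0" if "y \<ge> 0" for y
  proof -
    have "m k' y > 0" if "k' > k" for k'
    proof (rule ccontr)
      assume "\<not> m k' y > 0"
      then have "(k', y) \<in> Z" using Z_iff[of k' y] that k(1) \<open>y \<ge> 0\<close> by simp
      from max[OF this] that show False by simp
    qed
    moreover have "isCont (\<lambda>k. m k y) k"
      using continuous_m[of UNIV "\<lambda>k. k" "\<lambda>_. y"] by (auto simp: continuous_on_eq_continuous_at)
    then have "((\<lambda>k. m k y) \<longlongrightarrow> m k y) (at_right k)"
      unfolding isCont_def by (rule filterlim_mono) (auto intro: at_le)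
    moreover have "at_right k \<noteq> bot" by simp
    ultimately show ?thesis
      by (intro tendsto_lowerbound[of "\<lambda>k. m k y" _ "at_right k"]) (auto simp: eventually_at_filter less_imp_le)
  qed
  have mx: "m k x = 0" using k m_nonneg[of x] by simp
  have "x = 0"
  proof (rule ccontr)
    assume "x \<noteq> 0"
    then have "x > 0" using k by simp
    have "dm k x = 0"
      by (rule DERIV_local_min[OF m_has_derivative \<open>x > 0\<close>]) (use m_nonneg mx in auto)
    from no_zero_data[OF k(2) mx this] show False .
  qed
  moreover have "dm k 0 \<ge> 0"
  proof (rule ccontr)
    assume "\<not> dm k 0 \<ge> 0"
    then obtain d where d: "d > 0" "\<And>h. h > 0 \<Longrightarrow> h < d \<Longrightarrow> m k 0 > m k (0 + h)"
      using DERIV_neg_dec_right[OF m_has_derivative[of k 0]] by (auto simp: not_le)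
    have "m k (d / 2) < m k 0" using d(2)[of "d / 2"] d(1) by simp
    with m_nonneg[of "d / 2"] d(1) mx \<open>x = 0\<close> show False by simp
  qed
  moreover have "dm k 0 \<noteq> 0" using no_zero_data[of 0 k] mx \<open>x = 0\<close> by blast
  ultimately have "dm k 0 > 0" by simp
  then show thesis using that[of k] k mx \<open>x = 0\<close> by simp
qed

lemma exists_shooting_zero:
  assumes mean: "(\<integral>t. q t \<partial>Rplus) \<le> 0" and nz: "\<not> (AE t in Rplus. q t = 0)"
  obtains k where "k > 0" "dm k 0 = k * m k 0"
proof -
  define F where "F = (\<lambda>k. dm k 0 - k * m k 0)"
  obtain k0 where k0: "k0 \<ge> 0" "F k0 > 0" using exists_shooting_pos[OF assms] unfolding F_def by blast
  \<comment> \<open>Large enough that \<open>m K 0 \<ge> 1/2\<close> and that \<open>K/2\<close> exceeds the bound \<open>C q_norm\<close> on \<open>dm\<close>.\<close>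
  define K where "K = k0 + 2 * (C * q_norm) + 1"
  have CQ: "C * q_norm \<ge> 0" using C_nonneg q_norm_nonneg by simp
  have K: "K > 0" "K > k0" using k0 CQ by (auto simp: K_def)
  have "C * q_norm / (2 * K) \<le> 1 / 2" using K k0 CQ by (simp add: divide_le_eq K_def)
  then have "m K 0 \<ge> 1 / 2" using m_bound_large_k[OF K(1), of 0] by (simp add: abs_le_iff)
  then have "K * m K 0 \<ge> K * (1 / 2)" using K by (intro mult_left_mono) auto
  moreover have "K * (1 / 2) = k0 / 2 + C * q_norm + 1 / 2" by (simp add: K_def)
  ultimately have "F K < 0" using abs_le_D1[OF dm_bound[of K 0]] k0 unfolding F_def by linarith
  moreover have "continuous_on {k0..K} F"
    unfolding F_def by (intro continuous_intros continuous_on_subset[OF continuous_dm_0]) auto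
  ultimately obtain k where k: "k0 \<le> k" "k \<le> K" "F k = 0"
    using IVT2'[of F K 0 k0] k0 K by auto
  then have "k \<noteq> k0" using k0 by auto
  then show thesis using that[of k] k k0 by (simp add: F_def)
qed

end

section \<open>Membership in the operator domain\<close>
lemma integral_Rplus_Ioc:
  assumes "0 \<le> u" "u \<le> v"
  shows "integrable Rplus (indicator {u<..v} :: real \<Rightarrow> real)"
    and "(\<integral>t. indicator {u<..v} t \<partial>Rplus) = v - u"
proof -
  have eq: "(\<lambda>t. indicator {0<..} t *\<^sub>R indicator {u<..v} t) = (indicator {u<..v} :: real \<Rightarrow> real)"
    using assms by (auto simp: indicator_def fun_eq_iff)
  show "integrable Rplus (indicator {u<..v} :: real \<Rightarrow> real)"
    by (subst integrable_restrict_space) (simp_all only: eq, use assms in \<open>auto intro!: integrable_real_indicator\<close>)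
  show "(\<integral>t. indicator {u<..v} t \<partial>Rplus) = v - u"
    using assms by (subst integral_restrict_space) (simp_all only: eq, simp_all)
qed

text \<open>
  Half-open intervals are disjoint as soon as their interiors are, and the degenerate ones are empty, so
  repeated end points need no separate treatment.
\<close>
lemma sum_indicator_disjoint_le_1:
  fixes D :: "(real \<times> real) set"
  assumes D: "finite D" and disj: "pairwise (\<lambda>(u, v) (s, t). disjnt {u<..<v} {s<..<t}) D"
  shows "(\<Sum>(u, v)\<in>D. indicator {u<..v} t) \<le> (1::real)"
proof (cases "\<exists>d\<in>D. t \<in> {fst d<..snd d}")
  case True
  then obtain d where d: "d \<in> D" "t \<in> {fst d<..snd d}" by blast
  have "t \<notin> {fst e<..snd e}" if "e \<in> D" "e \<noteq> d" for e
  proof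
    assume e: "t \<in> {fst e<..snd e}"
    have "max (fst d) (fst e) < min (snd d) (snd e)" using d e by auto
    then obtain z where "max (fst d) (fst e) < z" "z < min (snd d) (snd e)" using dense by blast
    then have "z \<in> {fst d<..<snd d}" "z \<in> {fst e<..<snd e}" by auto
    then have "\<not> disjnt {fst d<..<snd d} {fst e<..<snd e}" unfolding disjnt_iff by blast
    moreover have "disjnt {fst d<..<snd d} {fst e<..<snd e}"
      using disj d(1) that unfolding pairwise_def by (auto simp: case_prod_beta)
    ultimately show False by simp
  qed
  then have "(\<Sum>(u, v)\<in>D. indicator {u<..v} t) = (\<Sum>(u, v)\<in>{d}. indicator {u<..v} t :: real)"
    using D d by (intro sum.mono_neutral_right) (auto simp: case_prod_beta)
  then show ?thesis by (simp add: case_prod_beta)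
next
  case False
  then have "(\<Sum>(u, v)\<in>D. indicator {u<..v} t) = (\<Sum>(u, v)\<in>D. 0 :: real)"
    by (intro sum.cong) (auto simp: case_prod_beta)
  then show ?thesis by simp
qed

text \<open>
  Splitting \<open>h\<close> at a height \<open>N\<close>, the part above \<open>N\<close> has integral less than \<open>\<epsilon>/2\<close> for large \<open>N\<close>, while
  the part below contributes at most \<open>N\<close> times the total length of the intervals.
\<close>
lemma absolutely_continuous_on_intervalI:
  fixes f :: "real \<Rightarrow> 'a::real_normed_vector" and h :: "real \<Rightarrow> real"
  assumes h: "integrable Rplus h" and h0: "\<And>t. h t \<ge> 0" and c: "c \<ge> 0"
    and f: "\<And>u v. 0 \<le> u \<Longrightarrow> u \<le> v \<Longrightarrow> v \<le> R \<Longrightarrow>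
      norm (f v - f u) \<le> c * (v - u) + (\<integral>t. indicator {u<..v} t * h t \<partial>Rplus)"
  shows "absolutely_continuous_on_interval 0 R f"
  unfolding absolutely_continuous_on_interval_def
proof (intro allI impI)
  fix \<epsilon> :: real assume \<epsilon>: "\<epsilon> > 0"
  have [measurable]: "h \<in> borel_measurable Rplus" using h by simp
  have "(\<lambda>N::nat. \<integral>t. max (h t - real N) 0 \<partial>Rplus) \<longlonglongrightarrow> (\<integral>t. 0 \<partial>Rplus)"
  proof (rule integral_dominated_convergence[OF _ _ h])
    show "AE t in Rplus. (\<lambda>N. max (h t - real N) 0) \<longlonglongrightarrow> 0"
    proof (rule AE_I2)
      fix t
      obtain N0 :: nat where "h t < real N0" using reals_Archimedean2 by blast
      then have "max (h t - real N) 0 = 0" if "N \<ge> N0" for N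
        using of_nat_mono[OF that, where 'a = real] by simp
      then have "\<forall>\<^sub>F N in sequentially. max (h t - real N) 0 = 0"
        by (auto simp: eventually_sequentially)
      then show "(\<lambda>N. max (h t - real N) 0) \<longlonglongrightarrow> 0" by (rule tendsto_eventually)
    qed
    show "AE t in Rplus. norm (max (h t - real N) 0) \<le> h t" for N
      using h0 by (intro AE_I2) (auto simp: max_def)
  qed measurable
  then have "\<forall>\<^sub>F N in sequentially. (\<integral>t. max (h t - real N) 0 \<partial>Rplus) < \<epsilon> / 2"
    using \<epsilon> by (intro order_tendstoD(2)) auto
  then obtain N :: nat where N: "(\<integral>t. max (h t - real N) 0 \<partial>Rplus) < \<epsilon> / 2"
    by (auto simp: eventually_sequentially)
  define \<delta> where "\<delta> = \<epsilon> / (2 * (real N + c + 1))"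
  have pos: "real N + c + 1 > 0" using c by simp
  have \<delta>: "\<delta> > 0" using \<epsilon> pos by (simp add: \<delta>_def)
  show "\<exists>\<delta>>0. \<forall>D :: (real \<times> real) set. finite D \<longrightarrow> (\<forall>(u, v)\<in>D. 0 \<le> u \<and> u \<le> v \<and> v \<le> R) \<longrightarrow>
        pairwise (\<lambda>(u, v) (s, t). disjnt {u<..<v} {s<..<t}) D \<longrightarrow>
        (\<Sum>(u, v)\<in>D. v - u) < \<delta> \<longrightarrow> (\<Sum>(u, v)\<in>D. norm (f v - f u)) < \<epsilon>"
  proof (intro exI[of _ \<delta>] conjI \<delta> allI impI)
    fix D :: "(real \<times> real) set"
    assume D: "finite D" and D_in: "\<forall>(u, v)\<in>D. 0 \<le> u \<and> u \<le> v \<and> v \<le> R"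
      and disj: "pairwise (\<lambda>(u, v) (s, t). disjnt {u<..<v} {s<..<t}) D"
      and small: "(\<Sum>(u, v)\<in>D. v - u) < \<delta>"
    let ?s = "\<Sum>(u, v)\<in>D. v - u"
    let ?i = "\<lambda>t. \<Sum>(u, v)\<in>D. indicator {u<..v} t :: real"
    have ind_h: "integrable Rplus (\<lambda>t. indicator {u<..v} t * h t)" for u v
      by (rule integrable_Rplus_mult_bounded[OF h, where C = 1])
        (auto simp: indicator_def intro!: measurable_restrict_space1 measurable_completion)
    have excess: "integrable Rplus (\<lambda>t. max (h t - real N) 0)"
      by (rule Bochner_Integration.integrable_bound[OF h]) (use h0 in \<open>auto simp: max_def\<close>)
    have ind_int: "integrable Rplus (indicator {fst d<..snd d} :: real \<Rightarrow> real)"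
      "(\<integral>t. indicator {fst d<..snd d} t \<partial>Rplus) = snd d - fst d" if "d \<in> D" for d
      using integral_Rplus_Ioc[of "fst d" "snd d"] D_in that by (auto simp: case_prod_beta)
    have i_int: "integrable Rplus ?i"
      unfolding case_prod_beta using ind_int by (intro Bochner_Integration.integrable_sum) simp
    have i_val: "(\<integral>t. ?i t \<partial>Rplus) = ?s"
      unfolding case_prod_beta using ind_int
      by (subst Bochner_Integration.integral_sum) auto
    have le1: "(\<Sum>(u, v)\<in>D. norm (f v - f u)) \<le> (\<Sum>(u, v)\<in>D. c * (v - u) + (\<integral>t. indicator {u<..v} t * h t \<partial>Rplus))"
      using D_in by (intro sum_mono) (auto intro!: f)
    have eq1: "(\<Sum>(u, v)\<in>D. c * (v - u) + (\<integral>t. indicator {u<..v} t * h t \<partial>Rplus))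
        = c * ?s + (\<integral>t. ?i t * h t \<partial>Rplus)"
      unfolding case_prod_beta sum_distrib_right sum.distrib sum_distrib_left
      by (subst Bochner_Integration.integral_sum) (auto intro: ind_h)
    have le2: "(\<integral>t. ?i t * h t \<partial>Rplus) \<le> (\<integral>t. real N * ?i t + max (h t - real N) 0 \<partial>Rplus)"
    proof (rule integral_mono)
      show "integrable Rplus (\<lambda>t. ?i t * h t)"
        unfolding case_prod_beta sum_distrib_right
        by (intro Bochner_Integration.integrable_sum ind_h)
      show "integrable Rplus (\<lambda>t. real N * ?i t + max (h t - real N) 0)"
        by (intro Bochner_Integration.integrable_add Bochner_Integration.integrable_mult_right i_int excess)
      fix t
      have i: "0 \<le> ?i t" "?i t \<le> 1"
        using sum_indicator_disjoint_le_1[OF D disj] by (auto intro!: sum_nonneg)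
      have "?i t * h t \<le> ?i t * (real N + max (h t - real N) 0)"
        using i by (intro mult_left_mono) auto
      also have "\<dots> \<le> real N * ?i t + 1 * max (h t - real N) 0"
        using mult_right_mono[OF i(2), of "max (h t - real N) 0"] by (simp add: algebra_simps)
      finally show "?i t * h t \<le> real N * ?i t + max (h t - real N) 0" by simp
    qed
    have eq2: "(\<integral>t. real N * ?i t + max (h t - real N) 0 \<partial>Rplus)
        = real N * ?s + (\<integral>t. max (h t - real N) 0 \<partial>Rplus)"
      using i_int excess i_val by simp
    have le: "(\<Sum>(u, v)\<in>D. norm (f v - f u)) \<le> (real N + c) * ?s + (\<integral>t. max (h t - real N) 0 \<partial>Rplus)"
      using le1 le2 unfolding eq1 eq2 distrib_right by linarith
    have "?s \<ge> 0" using D_in by (intro sum_nonneg) auto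
    then have "(real N + c) * ?s \<le> (real N + c + 1) * \<delta>"
      using small c by (intro mult_mono) auto
    also have "\<dots> = \<epsilon> / 2" using pos unfolding \<delta>_def by (simp add: divide_simps)
    finally show "(\<Sum>(u, v)\<in>D. norm (f v - f u)) < \<epsilon>" using le N by simp
  qed
qed

lemma integrable_exp_Rplus:
  assumes "a > 0"
  shows "integrable Rplus (\<lambda>x. exp (- a * x))"
proof -
  have "(\<lambda>x. exp (- a * x)) integrable_on {0<..}"
  proof (rule integrable_spike_set[OF integrable_on_exp_minus_to_infinity[OF assms, of 0]])
    show "negligible {x \<in> {0..} - {0<..}. exp (- a * x) \<noteq> 0}"
      by (rule negligible_subset[of "{0}"]) auto
    show "negligible {x \<in> {0<..} - {0..}. exp (- a * x) \<noteq> 0}"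
      by (rule negligible_subset[of "{}"]) auto
  qed
  then have "(\<lambda>x. exp (- a * x)) absolutely_integrable_on {0<..}"
    by (rule nonnegative_absolutely_integrable_1) simp
  then show ?thesis
    by (simp add: integrable_restrict_space set_integrable_def)
qed

lemma measurable_Rplus_AE_cong:
  fixes f g :: "real \<Rightarrow> complex"
  assumes f: "f \<in> borel_measurable Rplus" and ae: "AE x in Rplus. f x = g x"
  shows "g \<in> borel_measurable Rplus"
proof -
  have "(\<lambda>x. if x \<in> {0<..} then f x else 0) \<in> borel_measurable lebesgue"
    using f by (subst borel_measurable_if) simp_all
  moreover have "AE x in lebesgue. (if x \<in> {0<..} then f x else 0) = (if x \<in> {0<..} then g x else 0)"
    using ae by (auto simp: AE_restrict_space_iff elim: eventually_mono)
  ultimately have "(\<lambda>x. if x \<in> {0<..} then g x else 0) \<in> borel_measurable lebesgue"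
    by (rule borel_measurable_AE)
  then show ?thesis by (subst (asm) borel_measurable_if) simp_all
qed

context jost_family begin

text \<open>
  The eigenfunction is the Jost solution \<open>f = e\<^bsup>-kx\<^esup> m(k, x)\<close>: it decays exponentially because \<open>m\<close> is
  bounded, and \<open>f'(0) = m'(k, 0) - k m(k, 0) = 0\<close>. Its derivative is \<open>e\<^bsup>kx\<^esup> scaled_dm - k f\<close>, a
  combination of smooth factors with one tail integral; this gives both local absolute continuity and
  the differential equation almost everywhere.
\<close>
lemma eigenvalue_if_shooting_zero:
  assumes k: "k > 0" and zero: "dm k 0 = k * m k 0" and q: "\<And>t. q t = - (\<sigma> * V t)"
  shows "eigenvalue_Rplus (neumann_domain \<sigma> V) (schroedinger_op \<sigma> V) (complex_of_real (- k\<^sup>2))"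
proof -
  define f where "f = (\<lambda>x. exp (- k * x) * m k x)"
  define f' where "f' = (\<lambda>x. exp (- k * x) * (dm k x - k * m k x))"
  define \<psi> where "\<psi> = (\<lambda>x. complex_of_real (f x))"
  have f_der: "(f has_real_derivative f' x) (at x)" for x
    unfolding f_def f'_def
    by (auto intro!: derivative_eq_intros m_has_derivative simp: algebra_simps)
  have f'_der: "AE x in Rplus. (f' has_real_derivative (k\<^sup>2 + q x) * f x) (at x)"
    using dm_has_derivative_AE[of k]
  proof eventually_elim
    case (elim x)
    have e: "((\<lambda>x. exp (- k * x)) has_real_derivative - k * exp (- k * x)) (at x)"
      by (auto intro!: derivative_eq_intros)
    have d: "((\<lambda>x. dm k x - k * m k x) has_real_derivative
        (2 * \<bar>k\<bar> * dm k x + q x * m k x) - k * dm k x) (at x)"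
      by (intro DERIV_diff elim DERIV_cmult m_has_derivative)
    have "(- k * exp (- k * x)) * (dm k x - k * m k x)
        + ((2 * \<bar>k\<bar> * dm k x + q x * m k x) - k * dm k x) * exp (- k * x) = (k\<^sup>2 + q x) * f x"
      using k by (simp add: f_def algebra_simps power2_eq_square)
    with DERIV_mult[OF e d] show ?case unfolding f'_def by (simp only:)
  qed
  have \<psi>_der: "(\<psi> has_vector_derivative complex_of_real (f' x)) (at x within S)" for x S
    unfolding \<psi>_def
    by (rule has_vector_derivative_at_within[OF has_vector_derivative_of_real[OF f_der]])
  have deriv_\<psi>: "deriv_Rplus \<psi> x = complex_of_real (f' x)" if "x \<ge> 0" for x
    unfolding deriv_Rplus_def
  proof (rule vector_derivative_within[OF _ \<psi>_der])
    have "at_right x \<le> at x within {0..}" using that by (intro at_le) auto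
    then show "at x within {0..} \<noteq> bot" using trivial_limit_at_right_real[of x] by (auto simp: bot_unique)
  qed
  have f_cont: "continuous_on UNIV f"
    using f_der DERIV_isCont by (blast intro: continuous_at_imp_continuous_on)
  have f_le: "\<bar>f x\<bar> \<le> C * exp (- k * x)" if "x \<ge> 0" for x
    using m_bound[OF that, of k] by (simp add: f_def abs_mult)
  have sq_int: "integrable Rplus (\<lambda>x. (f x)\<^sup>2)"
  proof (rule Bochner_Integration.integrable_bound)
    show "integrable Rplus (\<lambda>x. C\<^sup>2 * exp (- (2 * k) * x))"
      using k by (intro Bochner_Integration.integrable_mult_right integrable_exp_Rplus) simp
    show "(\<lambda>x. (f x)\<^sup>2) \<in> borel_measurable Rplus"
      by (rule continuous_imp_measurable_Rplus) (intro continuous_intros f_cont)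
    show "AE x in Rplus. norm ((f x)\<^sup>2) \<le> norm (C\<^sup>2 * exp (- (2 * k) * x))"
    proof (rule AE_I2)
      fix x assume "x \<in> space Rplus"
      then have "\<bar>f x\<bar>\<^sup>2 \<le> (C * exp (- k * x))\<^sup>2" using f_le[of x] by (intro power_mono) auto
      also have "\<dots> = C\<^sup>2 * exp (- (2 * k) * x)"
        by (simp add: power_mult_distrib exp_double[symmetric] mult.assoc)
      finally show "norm ((f x)\<^sup>2) \<le> norm (C\<^sup>2 * exp (- (2 * k) * x))" by simp
    qed
  qed
  have L2_multiple: "(\<lambda>x. complex_of_real c * \<psi> x) \<in> L2_Rplus" for c
  proof -
    have "(\<lambda>x. complex_of_real c * \<psi> x) \<in> borel_measurable Rplus"
      unfolding \<psi>_def by (rule continuous_imp_measurable_Rplus) (intro continuous_intros f_cont)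
    moreover have "integrable Rplus (\<lambda>x. c\<^sup>2 * (f x)\<^sup>2)"
      using sq_int by (rule Bochner_Integration.integrable_mult_right)
    ultimately show ?thesis
      by (simp add: L2_Rplus_def \<psi>_def norm_mult power_mult_distrib)
  qed
  have eq: "AE x in Rplus. schroedinger_op \<sigma> V \<psi> x = complex_of_real (- k\<^sup>2) * \<psi> x"
    using f'_der AE_Rplus_pos
  proof eventually_elim
    case (elim x)
    have "((\<lambda>y. complex_of_real (f' y)) has_vector_derivative complex_of_real ((k\<^sup>2 + q x) * f x)) (at x)"
      using elim(1) by (rule has_vector_derivative_of_real)
    then have "(deriv_Rplus \<psi> has_vector_derivative complex_of_real ((k\<^sup>2 + q x) * f x)) (at x)"
      by (rule has_vector_derivative_transform_within_open[where S = "{0<..}"])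
        (use elim(2) deriv_\<psi> in auto)
    then have "vector_derivative (deriv_Rplus \<psi>) (at x) = complex_of_real ((k\<^sup>2 + q x) * f x)"
      by (rule vector_derivative_at)
    then show ?case by (simp add: schroedinger_op_def \<psi>_def q algebra_simps)
  qed
  have op_L2: "schroedinger_op \<sigma> V \<psi> \<in> L2_Rplus"
  proof -
    have eq': "AE x in Rplus. complex_of_real (- k\<^sup>2) * \<psi> x = schroedinger_op \<sigma> V \<psi> x"
      using eq by eventually_elim simp
    have meas: "(\<lambda>x. complex_of_real (- k\<^sup>2) * \<psi> x) \<in> borel_measurable Rplus"
      and int: "integrable Rplus (\<lambda>x. (norm (complex_of_real (- k\<^sup>2) * \<psi> x))\<^sup>2)"
      using L2_multiple[of "- k\<^sup>2"] by (simp_all only: L2_Rplus_def mem_Collect_eq)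
    have meas': "schroedinger_op \<sigma> V \<psi> \<in> borel_measurable Rplus"
      by (rule measurable_Rplus_AE_cong[OF meas eq'])
    have "integrable Rplus (\<lambda>x. (norm (schroedinger_op \<sigma> V \<psi> x))\<^sup>2)"
    proof (rule integrable_cong_AE_imp[OF int])
      show "(\<lambda>x. (norm (schroedinger_op \<sigma> V \<psi> x))\<^sup>2) \<in> borel_measurable Rplus"
        using meas' by measurable
      show "AE x in Rplus. (norm (complex_of_real (- k\<^sup>2) * \<psi> x))\<^sup>2 = (norm (schroedinger_op \<sigma> V \<psi> x))\<^sup>2"
        using eq by eventually_elim simp
    qed
    with meas' show ?thesis by (simp add: L2_Rplus_def)
  qed
  have ac: "absolutely_continuous_on_interval 0 R (deriv_Rplus \<psi>)" if R: "R > 0" for R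
  proof -
    define b where "b = C * q_norm + k * C"
    define c where "c = C * q_norm * (k * exp (k * R)) + k * b"
    have CQ: "C * q_norm \<ge> 0" using C_nonneg q_norm_nonneg by simp
    have b: "b \<ge> 0" using CQ C_nonneg k by (simp add: b_def)
    have f'_eq: "f' x = exp (k * x) * scaled_dm k x - k * f x" for x
    proof -
      have "2 * \<bar>k\<bar> * x = k * x + k * x" using k by simp
      then have "dm k x = (exp (k * x) * exp (k * x)) * scaled_dm k x" by (simp only: dm_eq_scaled_dm exp_add)
      then have eq: "exp (- k * x) * dm k x = (exp (- k * x) * exp (k * x)) * (exp (k * x) * scaled_dm k x)"
        by (simp only: mult_ac)
      have one: "exp (- k * x) * exp (k * x) = 1" by (simp add: exp_minus)
      have "exp (- k * x) * dm k x = exp (k * x) * scaled_dm k x"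
        using eq unfolding one mult_1_left .
      moreover have "f' x = exp (- k * x) * dm k x - k * f x"
        unfolding f'_def f_def right_diff_distrib by (simp only: mult_ac)
      ultimately show ?thesis by (simp only:)
    qed
    have f'_le: "\<bar>f' x\<bar> \<le> b" if "x \<ge> 0" for x
    proof -
      have "\<bar>dm k x - k * m k x\<bar> \<le> \<bar>dm k x\<bar> + k * \<bar>m k x\<bar>"
        using abs_triangle_ineq4[of "dm k x" "k * m k x"] k by (simp add: abs_mult)
      also have "\<dots> \<le> b" unfolding b_def using m_bound[OF that, of k] dm_bound[of k x] k
        by (intro add_mono mult_left_mono) auto
      finally have "exp (- k * x) * \<bar>dm k x - k * m k x\<bar> \<le> 1 * b"
        using that k by (intro mult_mono) auto
      then show ?thesis by (simp add: f'_def abs_mult)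
    qed
    have scaled_dm_le: "\<bar>scaled_dm k x\<bar> \<le> C * q_norm" if "x \<ge> 0" for x
    proof -
      have "1 * \<bar>scaled_dm k x\<bar> \<le> exp (2 * \<bar>k\<bar> * x) * \<bar>scaled_dm k x\<bar>"
        using that by (intro mult_right_mono) auto
      also have "\<dots> = \<bar>dm k x\<bar>" by (simp add: dm_eq_scaled_dm abs_mult)
      finally show ?thesis using dm_bound[of k x] by simp
    qed
    show ?thesis
    proof (rule absolutely_continuous_on_intervalI[where c = c and h = "\<lambda>t. exp (k * R) * C * \<bar>q t\<bar>"])
      show "integrable Rplus (\<lambda>t. exp (k * R) * C * \<bar>q t\<bar>)"
        by (intro Bochner_Integration.integrable_mult_right abs_q_int)
      show "0 \<le> exp (k * R) * C * \<bar>q t\<bar>" for t using C_nonneg by simp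
      show "c \<ge> 0" using CQ b k by (simp add: c_def)
      fix u v assume uv: "0 \<le> u" "u \<le> v" "v \<le> R"
      have 1: "\<bar>f v - f u\<bar> \<le> b * (v - u)"
        using field_differentiable_bound[of "{u..v}" f f' b v u] uv f'_le f_der
        by (auto intro: has_field_derivative_at_within)
      have 2: "\<bar>exp (k * v) - exp (k * u)\<bar> \<le> k * exp (k * R) * (v - u)"
      proof -
        have "((\<lambda>x. exp (k * x)) has_real_derivative k * exp (k * x)) (at x within {u..v})" for x
          by (auto intro!: derivative_eq_intros)
        moreover have "norm (k * exp (k * x)) \<le> k * exp (k * R)" if "x \<in> {u..v}" for x
          using that uv k by (auto simp: abs_mult)
        ultimately show ?thesis
          using field_differentiable_bound[of "{u..v}" "\<lambda>x. exp (k * x)" "\<lambda>x. k * exp (k * x)" "k * exp (k * R)" v u] uv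
          by auto
      qed
      have meas_ioc: "(\<lambda>t. indicator {u<..v} t :: real) \<in> borel_measurable Rplus"
        by (intro measurable_restrict_space1 measurable_completion borel_measurable_indicator) simp
      have 3: "\<bar>scaled_dm k v - scaled_dm k u\<bar> \<le> (\<integral>t. indicator {u<..v} t * (C * \<bar>q t\<bar>) \<partial>Rplus)"
      proof -
        have "\<bar>scaled_dm k v - scaled_dm k u\<bar> \<le> (\<integral>t. \<bar>indicator {u<..v} t * (exp (- (2 * \<bar>k\<bar>) * t) * (q t * m k t))\<bar> \<partial>Rplus)"
          unfolding scaled_dm_diff[OF uv(2)] by (rule integral_abs_bound)
        also have "\<dots> \<le> (\<integral>t. indicator {u<..v} t * (C * \<bar>q t\<bar>) \<partial>Rplus)"
        proof (rule integral_mono)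
          show "integrable Rplus (\<lambda>t. \<bar>indicator {u<..v} t * (exp (- (2 * \<bar>k\<bar>) * t) * (q t * m k t))\<bar>)"
            by (intro integrable_abs integrable_Rplus_mult_bounded[OF scaled_dm_integrand_int meas_ioc, where C = 1])
              (auto simp: indicator_def)
          show "integrable Rplus (\<lambda>t. indicator {u<..v} t * (C * \<bar>q t\<bar>))"
            by (intro integrable_Rplus_mult_bounded[OF _ meas_ioc, where C = 1]
                Bochner_Integration.integrable_mult_right abs_q_int) (auto simp: indicator_def)
          fix t assume "t \<in> space Rplus"
          then have "exp (- (2 * \<bar>k\<bar>) * t) * (\<bar>q t\<bar> * \<bar>m k t\<bar>) \<le> 1 * (\<bar>q t\<bar> * C)"
            by (intro mult_mono m_bound) auto
          then show "\<bar>indicator {u<..v} t * (exp (- (2 * \<bar>k\<bar>) * t) * (q t * m k t))\<bar> \<le> indicator {u<..v} t * (C * \<bar>q t\<bar>)"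
            by (auto simp: indicator_def abs_mult mult_ac)
        qed
        finally show ?thesis .
      qed
      have eq: "f' v - f' u = exp (k * v) * (scaled_dm k v - scaled_dm k u) + scaled_dm k u * (exp (k * v) - exp (k * u)) - k * (f v - f u)"
        by (simp add: f'_eq algebra_simps)
      have le1: "\<bar>f' v - f' u\<bar> \<le> exp (k * v) * \<bar>scaled_dm k v - scaled_dm k u\<bar> + \<bar>scaled_dm k u\<bar> * \<bar>exp (k * v) - exp (k * u)\<bar> + k * \<bar>f v - f u\<bar>"
      proof -
        have "\<bar>f' v - f' u\<bar> \<le> \<bar>exp (k * v) * (scaled_dm k v - scaled_dm k u)\<bar> + \<bar>scaled_dm k u * (exp (k * v) - exp (k * u))\<bar> + \<bar>k * (f v - f u)\<bar>"
          unfolding eq by linarith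
        then show ?thesis using k by (simp only: abs_mult abs_exp_cancel abs_of_pos)
      qed
      also have "\<dots> \<le> exp (k * R) * (\<integral>t. indicator {u<..v} t * (C * \<bar>q t\<bar>) \<partial>Rplus)
          + C * q_norm * (k * exp (k * R) * (v - u)) + k * (b * (v - u))"
        using uv k 1 2 3 scaled_dm_le[of u] CQ by (intro add_mono mult_mono) auto
      finally have le2: "\<bar>f' v - f' u\<bar> \<le> exp (k * R) * (\<integral>t. indicator {u<..v} t * (C * \<bar>q t\<bar>) \<partial>Rplus)
          + C * q_norm * (k * exp (k * R) * (v - u)) + k * (b * (v - u))" .
      have eq2: "exp (k * R) * (\<integral>t. indicator {u<..v} t * (C * \<bar>q t\<bar>) \<partial>Rplus)
          = (\<integral>t. indicator {u<..v} t * (exp (k * R) * C * \<bar>q t\<bar>) \<partial>Rplus)"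
        by (subst Bochner_Integration.integral_mult_right_zero[symmetric]) (simp only: mult_ac)
      have "C * q_norm * (k * exp (k * R) * (v - u)) + k * (b * (v - u)) = c * (v - u)"
        by (simp add: c_def algebra_simps)
      with le2 have "\<bar>f' v - f' u\<bar> \<le> c * (v - u) + (\<integral>t. indicator {u<..v} t * (exp (k * R) * C * \<bar>q t\<bar>) \<partial>Rplus)"
        unfolding eq2 by linarith
      then show "norm (deriv_Rplus \<psi> v - deriv_Rplus \<psi> u)
          \<le> c * (v - u) + (\<integral>t. indicator {u<..v} t * (exp (k * R) * C * \<bar>q t\<bar>) \<partial>Rplus)"
        using uv by (simp add: deriv_\<psi> flip: of_real_diff)
    qed
  qed
  have dom: "\<psi> \<in> neumann_domain \<sigma> V"
    unfolding neumann_domain_def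
  proof (intro CollectI conjI allI impI)
    show "\<psi> \<in> L2_Rplus" using L2_multiple[of 1] by simp
    show "\<psi> differentiable (at x within {0..})" for x
      using \<psi>_der by (rule differentiableI_vector)
    show "deriv_Rplus \<psi> 0 = 0" using deriv_\<psi>[of 0] zero by (simp add: f'_def)
  qed (use ac op_L2 in auto)
  have "\<not> (AE x in Rplus. \<psi> x = 0)"
  proof
    assume "AE x in Rplus. \<psi> x = 0"
    \<comment> \<open>Far out \<open>m\<close> exceeds \<open>1/2\<close>, so an interval of length 1 would be a null set.\<close>
    obtain X where X: "X \<ge> 0" "\<And>k x. x \<ge> X \<Longrightarrow> m k x > 1 / 2" using m_eventually_large by blast
    have "AE x in Rplus. x \<notin> {X<..X+1}"
      using \<open>AE x in Rplus. \<psi> x = 0\<close>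
    proof eventually_elim
      case (elim x)
      then show ?case using X(2)[of x k] by (auto simp: \<psi>_def f_def)
    qed
    then have "(\<integral>t. indicator {X<..X+1} t \<partial>Rplus) = (\<integral>t. (0::real) \<partial>Rplus)"
      using integral_Rplus_Ioc(1)[of X "X + 1"] X(1)
      by (intro integral_cong_AE) (auto elim: eventually_mono)
    then show False using integral_Rplus_Ioc(2)[of X "X + 1"] X(1) by simp
  qed
  with dom eq show ?thesis unfolding eigenvalue_Rplus_def by blast
qed

end

theorem theorem3p1:
  fixes V :: "real \<Rightarrow> real"
  assumes V_integrable: "integrable Rplus V"
    and V_moment: "integrable Rplus (\<lambda>x. x * \<bar>V x\<bar>)"
    and V_nonzero: "\<not> (AE x in Rplus. V x = 0)"
    and V_mean: "(\<integral>x. V x \<partial>Rplus) \<ge> 0"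
  shows "\<forall>\<sigma>>0. \<exists>\<mu><0.
           eigenvalue_Rplus (neumann_domain \<sigma> V) (schroedinger_op \<sigma> V) (complex_of_real \<mu>)"
proof (intro allI impI)
  fix \<sigma> :: real assume \<sigma>: "\<sigma> > 0"
  define q where "q = (\<lambda>t. - (\<sigma> * V t))"
  interpret half_line_potential q
  proof
    show "integrable Rplus q" unfolding q_def using V_integrable by simp
    have [measurable]: "V \<in> borel_measurable Rplus" using V_integrable by simp
    have [measurable]: "(\<lambda>t. t) \<in> borel_measurable Rplus"
      by (rule continuous_imp_measurable_Rplus) (intro continuous_intros)
    have "integrable Rplus (\<lambda>t. \<sigma> * (t * \<bar>V t\<bar>))" using V_moment by simp
    then show "integrable Rplus (\<lambda>t. t * q t)"
    proof (rule Bochner_Integration.integrable_bound)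
      show "(\<lambda>t. t * q t) \<in> borel_measurable Rplus" unfolding q_def by measurable
      show "AE t in Rplus. norm (t * q t) \<le> norm (\<sigma> * (t * \<bar>V t\<bar>))"
        by (rule AE_I2) (simp add: q_def abs_mult)
    qed
  qed
  obtain m C where "continuous_on UNIV (\<lambda>z. m (fst z) (snd z))"
    "\<And>k x. x \<ge> 0 \<Longrightarrow> \<bar>m k x\<bar> \<le> C"
    "\<And>k x. m k x = 1 + (\<integral>t. green (2 * \<bar>k\<bar>) (t - x) * (q t * m k t) \<partial>Rplus)"
    using jost_family_exists by blast
  then interpret jost_family q m C by unfold_locales
  have "(\<integral>t. q t \<partial>Rplus) \<le> 0" using V_mean \<sigma> by (simp add: q_def)
  moreover have "\<not> (AE t in Rplus. q t = 0)" using V_nonzero \<sigma> by (simp add: q_def)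
  ultimately obtain k where "k > 0" "dm k 0 = k * m k 0" using exists_shooting_zero by blast
  from eigenvalue_if_shooting_zero[OF this, of \<sigma> V]
  have "eigenvalue_Rplus (neumann_domain \<sigma> V) (schroedinger_op \<sigma> V) (complex_of_real (- k\<^sup>2))"
    by (simp add: q_def)
  moreover have "- k\<^sup>2 < 0" using \<open>k > 0\<close> by simp
  ultimately show "\<exists>\<mu><0. eigenvalue_Rplus (neumann_domain \<sigma> V) (schroedinger_op \<sigma> V) (complex_of_real \<mu>)"
    by blast
qed

end
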